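(* Let $N=2m+1$, $s=e^{2\pi i/N}$, $q$ real-valued in $L^2(0,1)$, and let $H$, $H_k$, $\vartheta,\varphi,\Delta,\mathcal M,\sigma_D$ be as described in the context. (i) The operator $H$ is unitarily equivalent to $\bigoplus_{k=1}^N H_k$. (ii) For every $\lambda\in\mathbb C\setminus\sigma_D$ and every $k\in\mathbb Z_N$ there exist unique families $\Theta_k(\cdot,\lambda)=(\Theta_{k,\alpha}(\cdot,\lambda))_{\alpha\in\mathbb Z\times\{0,1,2\}}$ and $\Phi_k(\cdot,\lambda)=(\Phi_{k,\alpha}(\cdot,\lambda))_{\alpha}$ of functions on the edges of $\Gamma^1$ such that on every edge $-f_\alpha''+qf_\alpha=\lambda f_\alpha$, the twisted conditions (K0),(K1) of the context hold for all $n\in\mathbb Z$, and, with $\beta=(0,0)$, $$\Theta_{k,\beta}(0,\lambda)=\Phi_{k,\beta}'(0,\lambda)=1,\qquad \Theta_{k,\beta}'(0,\lambda)=\Phi_{k,\beta}(0,\lambda)=0.$$ Moreover each of $\Theta_k(x,\lambda),\Phi_k(x,\lambda)$ ($x\in\Gamma^1$) is meromorphic in $\lambda\in\mathbb C\setminus\sigma_D$, and the monodromy matrix $$\mathcal M_k(\lambda)=\begin{pmatrix}\Theta_{k,\alpha}(0,\lambda)&\Phi_{k,\alpha}(0,\lambda)\\ \Theta_{k,\alpha}'(0,\lambda)&\Phi_{k,\alpha}'(0,\lambda)\end{pmatrix},\qquad \alpha=(1,0),$$ satisfies $$\mathcal M_k=\mathcal R^{-1}\mathcal T_k\mathcal R\,\mathcal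 M,\qquad \mathcal T_k=\frac{s^{-k/2}}{2c_k}\begin{pmatrix}2\Delta&1\\4\Delta^2-4c_k^2&2\Delta\end{pmatrix},\qquad \mathcal R=\begin{pmatrix}1&0\\0&\varphi(1,\cdot)\end{pmatrix}.$$ In particular $$\det\mathcal M_k=s^{-k},\qquad \operatorname{Tr}\mathcal M_k=\frac{2(\Delta_0+s_k^2)}{s^{k/2}c_k},\qquad \Delta_0\equiv\frac{\operatorname{Tr}\mathcal M_0}{2}=2\Delta^2+\frac{\vartheta'(1,\cdot)\varphi(1,\cdot)}{4}-1 .$$ Furthermore $\mathcal R\mathcal M_k\mathcal R^{-1}=\mathcal T_k\mathcal R\mathcal M\mathcal R^{-1}$ is an entire matrix-valued function of $\lambda$; in particular $D_k(\tau,\lambda)=\det(\mathcal M_k(\lambda)-\tau I_2)$ is entire in $(\lambda,\tau)\in\mathbb C^2$.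
   Context: Fix an integer $m\ge0$, $N=2m+1$, $s=e^{2\pi i/N}$, $s^{k/2}:=e^{i\pi k/N}$, $c_k=\cos\frac{\pi k}{N}$, $s_k=\sin\frac{\pi k}{N}$. Let $q$ be a real-valued function in $L^2(0,1)$. Zigzag graph $\Gamma^N$: metric graph with edges $\Gamma_{n,j,k}$, $(n,j,k)\in\mathbb Z\times\{0,1,2\}\times\mathbb Z_N$, each identified with $[0,1]$ via a coordinate $t$; for every $(n,k)$ one vertex joins the end $t=1$ of $\Gamma_{n,0,k}$, the end $t=0$ of $\Gamma_{n,1,k}$ and the end $t=1$ of $\Gamma_{n,2,k-1}$, and another vertex joins the end $t=0$ of $\Gamma_{n+1,0,k}$, the end $t=1$ of $\Gamma_{n,1,k}$ and the end $t=0$ of $\Gamma_{n,2,k}$. $L^2(\Gamma^N)=\bigoplus_\omega L^2(0,1)$. The operator $H$ acts by $(Hy)_\omega=-y_\omega''+qy_\omega$ on $y\in L^2(\Gamma^N)$ with $y_\omega\in W^{2,2}(0,1)$, $(y_\omega'')_\omega\in L^2(\Gamma^N)$, satisfying for all $(n,k)$: $y_{n,0,k}(1)=y_{n,1,k}(0)=y_{n,2,k-1}(1)$, $y_{n+1,0,k}(0)=y_{n,1,k}(1)=y_{n,2,k}(0)$, $-y'_{n,0,k}(1)+y'_{n,1,k}(0)-y'_{n,2,k-1}(1)=0$, $y'_{n+1,0,k}(0)-y'_{n,1,k}(1)+y'_{n,2,k}(0)=0$. Graph $\Gamma^1$: edges $\Gamma_{n,j}$, $(n,j)\in\mathbb Z\times\{0,1,2\}$,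 each identified with $[0,1]$. For $k\in\mathbb Z_N$ the operator $H_k$ in $L^2(\Gamma^1)=\bigoplus L^2(0,1)$ acts by $(H_kf)_\alpha=-f_\alpha''+qf_\alpha$ on $f\in L^2(\Gamma^1)$ with $f_\alpha\in W^{2,2}(0,1)$, $(f_\alpha'')\in L^2(\Gamma^1)$ and, for all $n\in\mathbb Z$, (K0) $f_{n,0}(1)=f_{n,1}(0)=s^kf_{n,2}(1)$, $f_{n+1,0}(0)=f_{n,1}(1)=f_{n,2}(0)$; (K1) $-f'_{n,0}(1)+f'_{n,1}(0)-s^kf'_{n,2}(1)=0$, $f'_{n+1,0}(0)-f'_{n,1}(1)+f'_{n,2}(0)=0$. Hill data: $\vartheta(x,\lambda),\varphi(x,\lambda)$ solve $-y''+qy=\lambda y$ on $[0,1]$ with $\vartheta(0)=\varphi'(0)=1$, $\vartheta'(0)=\varphi(0)=0$; $\mathcal M(\lambda)=\begin{pmatrix}\vartheta(1,\lambda)&\varphi(1,\lambda)\\ \vartheta'(1,\lambda)&\varphi'(1,\lambda)\end{pmatrix}$; $\Delta=\frac12(\varphi'(1,\cdot)+\vartheta(1,\cdot))$; $\sigma_D=\{\lambda\in\mathbb C:\varphi(1,\lambda)=0\}$ (the Dirichlet spectrum). *)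

theory Defs
  imports "HOL-Complex_Analysis.Complex_Analysis"
begin

definition L2_01 :: "(real \<Rightarrow> complex) \<Rightarrow> bool" where
  "L2_01 f \<longleftrightarrow> f \<in> borel_measurable (lebesgue_on {0..1}) \<and>
      integrable (lebesgue_on {0..1}) (\<lambda>t. (cmod (f t))^2)"

definition sqnorm01 :: "(real \<Rightarrow> complex) \<Rightarrow> real" where
  "sqnorm01 f = (LINT t|lebesgue_on {0..1}. (cmod (f t))^2)"

definition L2sp :: "'i set \<Rightarrow> ('i \<Rightarrow> real \<Rightarrow> complex) set" where
  "L2sp I = {f. (\<forall>i\<in>I. L2_01 (f i)) \<and> (\<lambda>i. sqnorm01 (f i)) summable_on I}"

definition L2norm :: "'i set \<Rightarrow> ('i \<Rightarrow> real \<Rightarrow> complex) \<Rightarrow> real" where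
  "L2norm I f = sqrt (infsum (\<lambda>i. sqnorm01 (f i)) I)"

definition aeq :: "'i set \<Rightarrow> ('i \<Rightarrow> real \<Rightarrow> complex) \<Rightarrow> ('i \<Rightarrow> real \<Rightarrow> complex) \<Rightarrow> bool" where
  "aeq I f g \<longleftrightarrow> (\<forall>i\<in>I. AE t in lebesgue_on {0..1}. f i t = g i t)"

text \<open>Unitary equivalence of two operators given by their graphs
  (sets of pairs (y, A y) of representatives); U is a unitary map between the L2 spaces
  mapping the graph of A onto the graph of B.\<close>
definition unitarily_equivalent ::
  "'i set \<Rightarrow> 'j set \<Rightarrow> (('i \<Rightarrow> real \<Rightarrow> complex) \<times> ('i \<Rightarrow> real \<Rightarrow> complex)) set
     \<Rightarrow> (('j \<Rightarrow> real \<Rightarrow> complex) \<times> ('j \<Rightarrow> real \<Rightarrow> complex)) set \<Rightarrow> bool" where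
  "unitarily_equivalent I J A B \<longleftrightarrow>
     (\<exists>U. (\<forall>f\<in>L2sp I. U f \<in> L2sp J) \<and>
          (\<forall>f\<in>L2sp I. \<forall>g\<in>L2sp I. \<forall>a b. 
              aeq J (U (\<lambda>i t. a * f i t + b * g i t)) (\<lambda>j t. a * U f j t + b * U g j t)) \<and>
          (\<forall>f\<in>L2sp I. L2norm J (U f) = L2norm I f) \<and>
          (\<forall>g\<in>L2sp J. \<exists>f\<in>L2sp I. aeq J (U f) g) \<and>
          (\<forall>(y,z)\<in>A. \<exists>(y',z')\<in>B. aeq J y' (U y) \<and> aeq J z' (U z)) \<and>
          (\<forall>(y',z')\<in>B. \<exists>(y,z)\<in>A. aeq J (U y) y' \<and> aeq J (U z) z'))"

definition W22 :: "(real \<Rightarrow> complex) \<Rightarrow> (real \<Rightarrow> complex) \<Rightarrow> (real \<Rightarrow> complex) \<Rightarrow> bool" where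
  "W22 f f' f'' \<longleftrightarrow> L2_01 f'' \<and>
     (\<forall>t\<in>{0..1}. (f'' has_integral (f' t - f' 0)) {0..t} \<and> (f' has_integral (f t - f 0)) {0..t})"

definition hill_sol :: "(real \<Rightarrow> real) \<Rightarrow> complex \<Rightarrow> (real \<Rightarrow> complex) \<Rightarrow> (real \<Rightarrow> complex) \<Rightarrow> bool" where
  "hill_sol q lam g g' \<longleftrightarrow>
     (\<forall>t\<in>{0..1}. (g' has_integral (g t - g 0)) {0..t} \<and>
        ((\<lambda>x. (complex_of_real (q x) - lam) * g x) has_integral (g' t - g' 0)) {0..t})"

text \<open>Edges of Gamma^N: (n,j,k) with j < 3, k < N (k represents Z_N).\<close>
definition EdgesN :: "nat \<Rightarrow> (int \<times> nat \<times> nat) set" where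
  "EdgesN N = {(n,j,k). j < 3 \<and> k < N}"

definition Edges1 :: "(int \<times> nat) set" where
  "Edges1 = {(n,j). j < 3}"

text \<open>Index set of the direct sum over k in Z_N of L2(Gamma^1).\<close>
definition EdgesSum :: "nat \<Rightarrow> (nat \<times> int \<times> nat) set" where
  "EdgesSum N = {(k,a). k < N \<and> a \<in> Edges1}"

definition kpred :: "nat \<Rightarrow> nat \<Rightarrow> nat" where
  "kpred N k = (k + N - 1) mod N"

definition sN :: "nat \<Rightarrow> complex" where
  "sN N = cis (2 * pi / real N)"

definition graph_H :: "(real \<Rightarrow> real) \<Rightarrow> nat \<Rightarrow>
    ((int \<times> nat \<times> nat \<Rightarrow> real \<Rightarrow> complex) \<times> (int \<times> nat \<times> nat \<Rightarrow> real \<Rightarrow> complex)) set" where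
  "graph_H q N = {(y,z). y \<in> L2sp (EdgesN N) \<and>
     (\<exists>D D2. (\<forall>w\<in>EdgesN N. W22 (y w) (D w) (D2 w)) \<and> D2 \<in> L2sp (EdgesN N) \<and>
        (\<forall>n k. k < N \<longrightarrow>
           y (n,0,k) 1 = y (n,1,k) 0 \<and> y (n,1,k) 0 = y (n,2,kpred N k) 1 \<and>
           y (n+1,0,k) 0 = y (n,1,k) 1 \<and> y (n,1,k) 1 = y (n,2,k) 0 \<and>
           - D (n,0,k) 1 + D (n,1,k) 0 - D (n,2,kpred N k) 1 = 0 \<and>
           D (n+1,0,k) 0 - D (n,1,k) 1 + D (n,2,k) 0 = 0) \<and>
        aeq (EdgesN N) z (\<lambda>w t. - D2 w t + complex_of_real (q t) * y w t))}"

definition K0K1 :: "nat \<Rightarrow> nat \<Rightarrow> (int \<times> nat \<Rightarrow> real \<Rightarrow> complex) \<Rightarrow> (int \<times> nat \<Rightarrow> real \<Rightarrow> complex) \<Rightarrow> bool" where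
  "K0K1 N k f D \<longleftrightarrow> (\<forall>n.
       f (n,0) 1 = f (n,1) 0 \<and> f (n,1) 0 = sN N ^ k * f (n,2) 1 \<and>
       f (n+1,0) 0 = f (n,1) 1 \<and> f (n,1) 1 = f (n,2) 0 \<and>
       - D (n,0) 1 + D (n,1) 0 - sN N ^ k * D (n,2) 1 = 0 \<and>
       D (n+1,0) 0 - D (n,1) 1 + D (n,2) 0 = 0)"

definition graph_Hk :: "(real \<Rightarrow> real) \<Rightarrow> nat \<Rightarrow> nat \<Rightarrow>
    ((int \<times> nat \<Rightarrow> real \<Rightarrow> complex) \<times> (int \<times> nat \<Rightarrow> real \<Rightarrow> complex)) set" where
  "graph_Hk q N k = {(f,g). f \<in> L2sp Edges1 \<and>
     (\<exists>D D2. (\<forall>a\<in>Edges1. W22 (f a) (D a) (D2 a)) \<and> D2 \<in> L2sp Edges1 \<and> K0K1 N k f D \<and>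
        aeq Edges1 g (\<lambda>a t. - D2 a t + complex_of_real (q t) * f a t))}"

definition graph_sum :: "(real \<Rightarrow> real) \<Rightarrow> nat \<Rightarrow>
    ((nat \<times> int \<times> nat \<Rightarrow> real \<Rightarrow> complex) \<times> (nat \<times> int \<times> nat \<Rightarrow> real \<Rightarrow> complex)) set" where
  "graph_sum q N = {(F,G). \<forall>k<N. ((\<lambda>a. F (k,a)), (\<lambda>a. G (k,a))) \<in> graph_Hk q N k}"

definition fam_sol :: "(real \<Rightarrow> real) \<Rightarrow> nat \<Rightarrow> nat \<Rightarrow> complex \<Rightarrow>
    (int \<times> nat \<Rightarrow> real \<Rightarrow> complex) \<Rightarrow> (int \<times> nat \<Rightarrow> real \<Rightarrow> complex) \<Rightarrow> bool" where
  "fam_sol q N k lam f D \<longleftrightarrow> (\<forall>a\<in>Edges1. hill_sol q lam (f a) (D a)) \<and> K0K1 N k f D"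

definition mat2 :: "complex \<Rightarrow> complex \<Rightarrow> complex \<Rightarrow> complex \<Rightarrow> complex^2^2" where
  "mat2 a b c d = (\<chi> i j. if i = 1 then (if j = 1 then a else b) else (if j = 1 then c else d))"

definition ck :: "nat \<Rightarrow> nat \<Rightarrow> real" where "ck N k = cos (pi * real k / real N)"
definition sk :: "nat \<Rightarrow> nat \<Rightarrow> real" where "sk N k = sin (pi * real k / real N)"

definition Tk :: "nat \<Rightarrow> nat \<Rightarrow> complex \<Rightarrow> complex^2^2" where
  "Tk N k Dl = (let c = complex_of_real (ck N k); f = cis (- pi * real k / real N) / (2 * c) in
      mat2 (f * (2 * Dl)) f (f * (4 * Dl^2 - 4 * c^2)) (f * (2 * Dl)))"

text \<open>Holomorphy of a function of two complex variables: complex Frechet differentiability on C^2.\<close>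
definition entire2 :: "(complex \<times> complex \<Rightarrow> complex) \<Rightarrow> bool" where
  "entire2 F \<longleftrightarrow> (\<forall>p. \<exists>A B. (F has_derivative (\<lambda>h. A * fst h + B * snd h)) (at p))"

end

theory Submission
  imports Defs "HOL-Real_Asymp.Real_Asymp"
begin

text \<open>
  (i) The zigzag graph is invariant under rotation of the \<open>Z\<^sub>N\<close> index, so the unitary discrete Fourier
  transform with kernel \<open>s\<^bsup>kl\<^esup>\<close> in that index diagonalises the shift \<open>k \<mapsto> k - 1\<close> of the Kirchhoff
  conditions into the twist \<open>s\<^sup>k\<close>.

  (ii) Off the Dirichlet spectrum the Kirchhoff conditions at the two vertices of cell \<open>n\<close> are a linear
  system that determines the initial data on all edges of the cell, and on the first edge of
  cell \<open>n + 1\<close>, from those on edge \<open>(n, 0)\<close>; it is solvable because \<open>1 + s\<^sup>k = 2 c\<^sub>k s\<^bsup>k/2\<^esup>\<close> does not vanish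
  for odd \<open>N\<close>. The resulting 2x2 matrix is \<open>\<M>\<^sub>k\<close>. A Gronwall estimate with integrable kernel
  gives uniqueness for the Hill equation and, applied to difference quotients in \<open>\<lambda>\<close>, which are then
  Cauchy as \<open>\<lambda> \<rightarrow> \<mu>\<close>, complex differentiability of its solutions.
\<close>

section \<open>Discrete Fourier transform and unitary equivalence\<close>

text \<open>Since q is only in L^2, the derivative of a solution is merely an indefinite integral.
  Arguments about the Hill equation therefore run on integrals over subintervals, and the Wronskian
  identity needs an increment argument of its own. The fundamental solutions are data of the
  statement; what must be shown is their regularity in \<lambda>. No inhomogeneous problem is solved
  for this: the derivative in \<lambda> only appears as a limit that exists by completeness.

  The Wronskian identity det M = 1 gives the cell matrix the determinant s^(-k), so the cells can
  also be traversed towards negative n.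

  On sigma_D the formulas for M_k divide by zero. The only denominator depending on \<lambda> is
  \<phi>(1,\<lambda>), and conjugation by R removes it: R M R^(-1) has the entire entries \<theta>,
  1, \<phi> \<theta>', \<phi>'. For D_k, trace and determinant suffice; both have closed formulas
  without \<phi> in a denominator.\<close>

text \<open>The crude bound |a + b|^2 <= 2|a|^2 + 2|b|^2 can be integrated and then summed over the
  edges, so closure of \<open>L2sp\<close> under addition follows by comparison.\<close>

lemma L2_01_add:
  assumes "L2_01 f" "L2_01 g"
  shows "L2_01 (\<lambda>t. f t + g t)"
    and "sqnorm01 (\<lambda>t. f t + g t) \<le> 2 * sqnorm01 f + 2 * sqnorm01 g"
proof -
  have m: "f \<in> borel_measurable (lebesgue_on {0..1})" "g \<in> borel_measurable (lebesgue_on {0..1})"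
    and i: "integrable (lebesgue_on {0..1}) (\<lambda>t. 2 * (cmod (f t))\<^sup>2 + 2 * (cmod (g t))\<^sup>2)"
    using assms by (auto simp: L2_01_def)
  have le: "(cmod (f t + g t))\<^sup>2 \<le> 2 * (cmod (f t))\<^sup>2 + 2 * (cmod (g t))\<^sup>2" for t
  proof -
    have "(cmod (f t + g t))\<^sup>2 \<le> (cmod (f t) + cmod (g t))\<^sup>2"
      by (intro power_mono norm_triangle_ineq) auto
    also have "\<dots> \<le> 2 * (cmod (f t))\<^sup>2 + 2 * (cmod (g t))\<^sup>2"
      using sum_squares_bound[of "cmod (f t)" "cmod (g t)"] by (simp add: power2_sum)
    finally show ?thesis .
  qed
  have int: "integrable (lebesgue_on {0..1}) (\<lambda>t. (cmod (f t + g t))\<^sup>2)"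
    by (rule Bochner_Integration.integrable_bound[OF i]) (use m le in \<open>auto intro!: AE_I2\<close>)
  then show "L2_01 (\<lambda>t. f t + g t)"
    using m by (simp add: L2_01_def)
  have "sqnorm01 (\<lambda>t. f t + g t) \<le> (LINT t|lebesgue_on {0..1}. 2 * (cmod (f t))\<^sup>2 + 2 * (cmod (g t))\<^sup>2)"
    unfolding sqnorm01_def by (intro integral_mono int i le)
  also have "\<dots> = 2 * sqnorm01 f + 2 * sqnorm01 g"
    using assms by (simp add: sqnorm01_def L2_01_def)
  finally show "sqnorm01 (\<lambda>t. f t + g t) \<le> 2 * sqnorm01 f + 2 * sqnorm01 g" .
qed

lemma L2_01_cmult: "L2_01 f \<Longrightarrow> L2_01 (\<lambda>t. c * f t)"
  by (auto simp: L2_01_def norm_mult power_mult_distrib)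

lemma sqnorm01_cmult: "sqnorm01 (\<lambda>t. c * f t) = (cmod c)\<^sup>2 * sqnorm01 f"
  by (simp add: sqnorm01_def norm_mult power_mult_distrib)

lemma L2_01_sum:
  assumes "finite A" "\<And>l. l \<in> A \<Longrightarrow> L2_01 (f l)"
  shows "L2_01 (\<lambda>t. \<Sum>l\<in>A. c l * f l t)"
  using assms
proof (induction rule: finite_induct)
  case empty
  then show ?case by (simp add: L2_01_def)
next
  case (insert x F)
  then show ?case
    using L2_01_add(1)[OF L2_01_cmult[of "f x" "c x"], of "\<lambda>t. \<Sum>l\<in>F. c l * f l t"] by auto
qed

lemma sqnorm01_nonneg [simp]: "0 \<le> sqnorm01 f"
  by (simp add: sqnorm01_def)

lemma L2sp_add:
  assumes f: "f \<in> L2sp I" and g: "g \<in> L2sp I"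
  shows "(\<lambda>i t. f i t + g i t) \<in> L2sp I"
proof -
  have "(\<lambda>i. 2 * sqnorm01 (f i) + 2 * sqnorm01 (g i)) summable_on I"
    using f g by (intro summable_on_add summable_on_cmult_right) (auto simp: L2sp_def)
  then have "(\<lambda>i. sqnorm01 (\<lambda>t. f i t + g i t)) summable_on I"
    by (rule summable_on_comparison_test) (use f g in \<open>auto simp: L2sp_def intro!: L2_01_add(2)\<close>)
  then show ?thesis
    using f g by (auto simp: L2sp_def intro!: L2_01_add(1))
qed

lemma L2sp_cmult: "f \<in> L2sp I \<Longrightarrow> (\<lambda>i t. c * f i t) \<in> L2sp I"
  by (auto simp: L2sp_def L2_01_cmult sqnorm01_cmult intro!: summable_on_cmult_right)

lemma L2sp_sum:
  assumes "finite A" "\<And>l. l \<in> A \<Longrightarrow> f l \<in> L2sp I"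
  shows "(\<lambda>i t. \<Sum>l\<in>A. c l * f l i t) \<in> L2sp I"
  using assms
proof (induction rule: finite_induct)
  case empty
  then show ?case by (simp add: L2sp_def L2_01_def sqnorm01_def)
next
  case (insert x F)
  then show ?case
    using L2sp_add[OF L2sp_cmult[of "f x" I "c x"], of "\<lambda>i t. \<Sum>l\<in>F. c l * f l i t"] by auto
qed

lemma W22_sum:
  assumes "finite A" "\<And>l. l \<in> A \<Longrightarrow> W22 (f l) (D l) (D2 l)"
  shows "W22 (\<lambda>t. \<Sum>l\<in>A. c l * f l t) (\<lambda>t. \<Sum>l\<in>A. c l * D l t) (\<lambda>t. \<Sum>l\<in>A. c l * D2 l t)"
  unfolding W22_def
proof (intro conjI ballI)
  show "L2_01 (\<lambda>t. \<Sum>l\<in>A. c l * D2 l t)"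
    using assms by (intro L2_01_sum) (auto simp: W22_def)
  fix t :: real assume "t \<in> {0..1}"
  then have "((\<lambda>t. \<Sum>l\<in>A. c l * D2 l t) has_integral (\<Sum>l\<in>A. c l * (D l t - D l 0))) {0..t}"
    and "((\<lambda>t. \<Sum>l\<in>A. c l * D l t) has_integral (\<Sum>l\<in>A. c l * (f l t - f l 0))) {0..t}"
    using assms by (auto simp: W22_def intro!: has_integral_sum has_integral_mult_right)
  then show "((\<lambda>t. \<Sum>l\<in>A. c l * D2 l t) has_integral (\<Sum>l\<in>A. c l * D l t) - (\<Sum>l\<in>A. c l * D l 0)) {0..t}"
    and "((\<lambda>t. \<Sum>l\<in>A. c l * D l t) has_integral (\<Sum>l\<in>A. c l * f l t) - (\<Sum>l\<in>A. c l * f l 0)) {0..t}"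
    by (simp_all add: sum_subtractf right_diff_distrib)
qed

section \<open>The unitary Fourier transform on Z_N\<close>

text \<open>The root \<open>w\<close> is a parameter so that the inverse transform is the same
  definition at \<open>cnj w\<close>.\<close>

definition dft :: "complex \<Rightarrow> nat \<Rightarrow> (nat \<Rightarrow> complex) \<Rightarrow> nat \<Rightarrow> complex" where
  "dft w N c k = (\<Sum>l<N. w ^ (k * l) / complex_of_real (sqrt (real N)) * c l)"

text \<open>Primitivity is expressed as injectivity of the powers below N, the form that
  orthogonality consumes: distinct indices have a ratio of powers other than 1.\<close>

definition prim_root :: "complex \<Rightarrow> nat \<Rightarrow> bool" where
  "prim_root w N \<longleftrightarrow> N > 0 \<and> w ^ N = 1 \<and> cmod w = 1 \<and> inj_on (\<lambda>l. w ^ l) {..<N}"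

lemma prim_root_sN: "N > 0 \<Longrightarrow> prim_root (sN N) N"
  unfolding prim_root_def
proof (intro conjI)
  assume N: "N > 0"
  then show "sN N ^ N = 1"
    using cis_2pi by (simp add: sN_def Complex.DeMoivre)
  show "cmod (sN N) = 1"
    by (simp add: sN_def)
  show "inj_on (\<lambda>l. sN N ^ l) {..<N}"
    using bij_betw_imp_inj_on[OF Complex.bij_betw_roots_unity[OF N]]
    by (simp add: sN_def Complex.DeMoivre mult_ac)
qed auto

lemma prim_root_cnj: "prim_root w N \<Longrightarrow> prim_root (cnj w) N"
  unfolding prim_root_def inj_on_def
  by (metis complex_cnj_cancel_iff complex_cnj_one complex_cnj_power complex_mod_cnj)

lemma mult_cnj_unit: "cmod w = 1 \<Longrightarrow> w * cnj w = 1"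
  by (simp add: complex_norm_square[symmetric])

text \<open>The sum is geometric with ratio z = w^l * cnj w^l'. For distinct indices z differs from
  1 while z^N = 1, so the numerator of the geometric sum vanishes.\<close>

lemma prim_root_orthogonal:
  assumes w: "prim_root w N" and l: "l < N" "l' < N"
  shows "(\<Sum>k<N. w ^ (k * l) * cnj w ^ (k * l')) = (if l = l' then of_nat N else 0)"
proof -
  define z where "z = w ^ l * cnj w ^ l'"
  have 1: "w * cnj w = 1"
    using w by (intro mult_cnj_unit) (simp add: prim_root_def)
  have eq: "(\<Sum>k<N. w ^ (k * l) * cnj w ^ (k * l')) = (\<Sum>k<N. z ^ k)"
    by (intro sum.cong) (simp_all add: z_def power_mult_distrib power_mult[symmetric] mult_ac)
  show ?thesis
  proof (cases "l = l'")
    case True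
    then have "z = 1"
      by (simp add: z_def 1 power_mult_distrib[symmetric])
    then show ?thesis using eq True by simp
  next
    case False
    have "z * w ^ l' = w ^ l * (w * cnj w) ^ l'"
      by (simp add: z_def power_mult_distrib)
    then have "z * w ^ l' = w ^ l" by (simp add: 1)
    moreover have "w ^ l \<noteq> w ^ l'"
      using w False l by (auto simp: prim_root_def inj_on_def)
    ultimately have "z \<noteq> 1" by auto
    moreover have "z ^ N = (w ^ N) ^ l * cnj (w ^ N) ^ l'"
      by (simp add: z_def power_mult_distrib power_mult[symmetric] mult_ac)
    ultimately show ?thesis
      using eq False w by (simp add: prim_root_def geometric_sum flip: complex_cnj_power)
  qed
qed

lemma dft_cnj_dft:
  assumes w: "prim_root w N" and k: "k < N"
  shows "dft w N (dft (cnj w) N c) k = c k"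
proof -
  have N: "complex_of_real (sqrt (real N)) * complex_of_real (sqrt (real N)) = of_nat N"
    by (metis of_nat_0_le_iff of_real_mult of_real_of_nat_eq real_sqrt_mult_self abs_of_nonneg)
  have "dft w N (dft (cnj w) N c) k
      = (\<Sum>l<N. \<Sum>j<N. w ^ (k * l) * cnj w ^ (l * j) / of_nat N * c j)"
    by (simp add: dft_def sum_distrib_left N[symmetric] mult_ac)
  also have "\<dots> = (\<Sum>j<N. (\<Sum>l<N. w ^ (l * k) * cnj w ^ (l * j)) / of_nat N * c j)"
    by (subst sum.swap) (simp add: sum_distrib_right sum_divide_distrib mult.commute[of k])
  also have "\<dots> = (\<Sum>j<N. if j = k then c j else 0)"
    using k w by (intro sum.cong) (auto simp: prim_root_orthogonal prim_root_def)
  finally show ?thesis using k by simp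
qed

text \<open>Read off from inversion: the kernel w^(kl) is symmetric in k and l, so exchanging the
  sums turns the left side into the sum of c times the transform of the
  \<open>cnj w\<close>-transform of cnj c, which is cnj c.\<close>

lemma dft_Parseval:
  assumes w: "prim_root w N"
  shows "(\<Sum>k<N. (cmod (dft w N c k))\<^sup>2) = (\<Sum>l<N. (cmod (c l))\<^sup>2)"
proof -
  have cnj: "cnj (dft w N c k) = dft (cnj w) N (\<lambda>l. cnj (c l)) k" for k
    by (simp add: dft_def)
  have expand: "dft w N c k * z = (\<Sum>l<N. c l * (w ^ (l * k) / complex_of_real (sqrt (real N)) * z))" for k z
    by (simp add: dft_def sum_distrib_left sum_distrib_right mult_ac)
  have "complex_of_real (\<Sum>k<N. (cmod (dft w N c k))\<^sup>2) = (\<Sum>k<N. dft w N c k * cnj (dft w N c k))"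
    by (simp add: complex_norm_square flip: of_real_power)
  also have "\<dots> = (\<Sum>k<N. \<Sum>l<N. c l * (w ^ (l * k) / complex_of_real (sqrt (real N)) * cnj (dft w N c k)))"
    by (simp only: expand)
  also have "\<dots> = (\<Sum>l<N. c l * dft w N (dft (cnj w) N (\<lambda>l. cnj (c l))) l)"
    by (subst sum.swap)
       (simp only: cnj sum_distrib_left[symmetric] dft_def[of w N "dft (cnj w) N (\<lambda>l. cnj (c l))", symmetric])
  also have "\<dots> = (\<Sum>l<N. c l * cnj (c l))"
    using w by (intro sum.cong) (auto simp: dft_cnj_dft)
  also have "\<dots> = complex_of_real (\<Sum>l<N. (cmod (c l))\<^sup>2)"
    by (simp add: complex_norm_square flip: of_real_power)
  finally show ?thesis by (simp only: of_real_eq_iff)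
qed

lemma dft_linear: "dft w N (\<lambda>l. a * c l + b * d l) k = a * dft w N c k + b * dft w N d k"
  by (simp add: dft_def sum.distrib sum_distrib_left distrib_left add_divide_distrib mult_ac)

lemma dft_add: "dft w N (\<lambda>l. c l + d l) k = dft w N c k + dft w N d k"
  and dft_minus: "dft w N (\<lambda>l. - c l) k = - dft w N c k"
  and dft_diff: "dft w N (\<lambda>l. c l - d l) k = dft w N c k - dft w N d k"
  and dft_0: "dft w N (\<lambda>l. 0) k = 0"
  and dft_cmult: "dft w N (\<lambda>l. a * c l) k = a * dft w N c k"
  using dft_linear[of w N 1 c 1 d k] dft_linear[of w N "-1" c 0 d k]
    dft_linear[of w N 1 c "-1" d k] dft_linear[of w N 0 c 0 d k] dft_linear[of w N a c 0 d k]
  by simp_all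

lemma dft_cong: "(\<And>l. l < N \<Longrightarrow> c l = d l) \<Longrightarrow> dft w N c k = dft w N d k"
  by (simp add: dft_def)

text \<open>Reindexing by l - 1 multiplies the kernel by w^k, and w^N = 1 makes the exponent well
  defined modulo N. This is how the neighbour k - 1 in the vertex conditions becomes the
  twist.\<close>

lemma dft_shift:
  assumes w: "prim_root w N"
  shows "dft w N (\<lambda>l. c (kpred N l)) k = w ^ k * dft w N c k"
proof -
  have N: "N > 0" and wN: "w ^ N = 1" using w by (auto simp: prim_root_def)
  have "bij_betw (kpred N) {..<N} {..<N}"
    by (rule bij_betw_byWitness[where f' = "\<lambda>l. Suc l mod N"])
       (use N in \<open>auto simp: kpred_def mod_simps mod_if\<close>)
  have wmod: "w ^ (k * (i mod N)) = w ^ (k * i)" for i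
  proof -
    have "w ^ i = w ^ (N * (i div N) + i mod N)" by simp
    also have "\<dots> = w ^ (i mod N)"
      by (simp only: power_add power_mult wN power_one mult_1)
    finally show ?thesis
      by (metis power_mult power_commutes mult.commute)
  qed
  have "w ^ k * dft w N c k = (\<Sum>l<N. w ^ (k * (Suc l mod N)) / complex_of_real (sqrt (real N)) * c l)"
    by (simp add: dft_def sum_distrib_left wmod power_add mult_ac)
  also have "\<dots> = (\<Sum>l<N. w ^ (k * (Suc (kpred N l) mod N)) / complex_of_real (sqrt (real N)) * c (kpred N l))"
    by (rule sum.reindex_bij_betw[symmetric]) fact
  also have "\<dots> = dft w N (\<lambda>l. c (kpred N l)) k"
    unfolding dft_def
  proof (intro sum.cong refl)
    fix l assume "l \<in> {..<N}"
    then have "Suc (kpred N l) mod N = l" using N by (auto simp: kpred_def mod_Suc mod_if)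
    then show "w ^ (k * (Suc (kpred N l) mod N)) / complex_of_real (sqrt (real N)) * c (kpred N l)
        = w ^ (k * l) / complex_of_real (sqrt (real N)) * c (kpred N l)" by simp
  qed
  finally show ?thesis by simp
qed

text \<open>Dual of the shift rule, for the way back: the twist w^k under the inverse transform
  becomes the neighbour l - 1.\<close>

lemma dft_cnj_modulate:
  assumes w: "prim_root w N" and l: "l < N"
  shows "dft (cnj w) N c (kpred N l) = dft (cnj w) N (\<lambda>k. w ^ k * c k) l"
proof -
  have 1: "cnj w * w = 1" and wN: "cnj w ^ N = 1"
    using mult_cnj_unit[of w] prim_root_cnj[OF w] w by (auto simp: prim_root_def mult.commute)
  have "cnj w ^ kpred N l * cnj w = cnj w ^ l"
  proof (cases l)
    \<comment> \<open>Here \<open>kpred\<close> wraps around to N - 1, and w^N = 1 closes the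
      cycle.\<close>
    case 0
    then have "cnj w ^ kpred N l * cnj w = cnj w ^ N"
      using l by (simp add: kpred_def flip: power_Suc2)
    then show ?thesis using 0 wN by simp
  next
    case (Suc i)
    then have "kpred N l = i" using l by (simp add: kpred_def)
    then show ?thesis using Suc by simp
  qed
  then have "cnj w ^ kpred N l * (cnj w * w) = cnj w ^ l * w"
    by (simp add: mult.assoc[symmetric])
  then have "cnj w ^ kpred N l = cnj w ^ l * w" by (simp add: 1)
  then have "cnj w ^ (kpred N l * k) = cnj w ^ (l * k) * w ^ k" for k
    by (simp add: power_mult power_mult_distrib)
  then show ?thesis
    by (simp add: dft_def mult_ac)
qed

section \<open>Square-summable families on the edges\<close>

text \<open>With a finite first factor, summability can be checked fibre by fibre; the second
  identity puts the sum over k innermost, where Parseval applies.\<close>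

lemma summable_on_finite_Times:
  fixes h :: "'a \<Rightarrow> 'b \<Rightarrow> real"
  assumes fin: "finite A" and nonneg: "\<And>k a. 0 \<le> h k a"
  shows "(\<lambda>(k, a). h k a) summable_on (A \<times> E) \<longleftrightarrow> (\<forall>k\<in>A. h k summable_on E)"
    and "\<forall>k\<in>A. h k summable_on E \<Longrightarrow>
      infsum (\<lambda>(k, a). h k a) (A \<times> E) = infsum (\<lambda>a. \<Sum>k\<in>A. h k a) E"
proof -
  have *: "(\<lambda>(k, a). h k a) summable_on (A \<times> E)" if "\<forall>k\<in>A. h k summable_on E"
    by (rule summable_on_SigmaI[where g = "\<lambda>k. infsum (h k) E"])
       (use that fin nonneg in \<open>auto intro!: has_sum_infsum\<close>)
  then show "(\<lambda>(k, a). h k a) summable_on (A \<times> E) \<longleftrightarrow> (\<forall>k\<in>A. h k summable_on E)"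
    using summable_on_SigmaD1[of h A "\<lambda>_. E"] by blast
  assume "\<forall>k\<in>A. h k summable_on E"
  note s = *[OF this]
  have "infsum (\<lambda>(k, a). h k a) (A \<times> E) = infsum (\<lambda>k. infsum (h k) E) A"
    using infsum_Sigma'_banach[OF s] by simp
  also have "\<dots> = infsum (\<lambda>a. infsum (\<lambda>k. h k a) A) E"
    by (rule infsum_swap_banach[OF s])
  finally show "infsum (\<lambda>(k, a). h k a) (A \<times> E) = infsum (\<lambda>a. \<Sum>k\<in>A. h k a) E"
    using fin by simp
qed

lemma EdgesSum_eq: "EdgesSum N = {..<N} \<times> Edges1"
  by (auto simp: EdgesSum_def)

lemma bij_betw_EdgesN: "bij_betw (\<lambda>(k, n, j). (n, j, k)) (EdgesSum N) (EdgesN N)"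
  by (rule bij_betw_byWitness[where f' = "\<lambda>(n, j, k). (k, n, j)"])
     (auto simp: EdgesSum_def Edges1_def EdgesN_def)

definition to_sum :: "(int \<times> nat \<times> nat \<Rightarrow> 'a) \<Rightarrow> nat \<times> int \<times> nat \<Rightarrow> 'a" where
  "to_sum f = (\<lambda>(k, n, j). f (n, j, k))"

lemma L2sp_to_sum: "to_sum f \<in> L2sp (EdgesSum N) \<longleftrightarrow> f \<in> L2sp (EdgesN N)"
proof -
  have "(\<lambda>i. sqnorm01 (to_sum f i)) summable_on EdgesSum N \<longleftrightarrow> (\<lambda>i. sqnorm01 (f i)) summable_on EdgesN N"
    using summable_on_reindex_bij_betw[OF bij_betw_EdgesN, of "\<lambda>i. sqnorm01 (f i)"]
    by (simp add: to_sum_def case_prod_unfold)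
  moreover have "(\<forall>i\<in>EdgesSum N. L2_01 (to_sum f i)) \<longleftrightarrow> (\<forall>i\<in>EdgesN N. L2_01 (f i))"
    by (auto simp: to_sum_def EdgesSum_def Edges1_def EdgesN_def)
  ultimately show ?thesis by (simp add: L2sp_def)
qed

lemma L2norm_to_sum: "L2norm (EdgesSum N) (to_sum f) = L2norm (EdgesN N) f"
  using infsum_reindex_bij_betw[OF bij_betw_EdgesN, of "\<lambda>i. sqnorm01 (f i)" N]
  by (simp add: L2norm_def to_sum_def case_prod_unfold)

lemma L2sp_EdgesSum_iff:
  "F \<in> L2sp (EdgesSum N) \<longleftrightarrow> (\<forall>k<N. (\<lambda>a. F (k, a)) \<in> L2sp Edges1)"
proof -
  have "(\<lambda>i. sqnorm01 (F i)) = (\<lambda>(k, a). sqnorm01 (F (k, a)))" by auto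
  then show ?thesis
    by (auto simp: L2sp_def EdgesSum_eq summable_on_finite_Times)
qed

lemma L2sp_EdgesSumD: "F \<in> L2sp (EdgesSum N) \<Longrightarrow> k < N \<Longrightarrow> (\<lambda>a. F (k, a)) \<in> L2sp Edges1"
  by (simp add: L2sp_EdgesSum_iff)

lemma L2norm_EdgesSum:
  assumes "F \<in> L2sp (EdgesSum N)"
  shows "L2norm (EdgesSum N) F = sqrt (infsum (\<lambda>a. \<Sum>k<N. sqnorm01 (F (k, a))) Edges1)"
proof -
  have "(\<lambda>i. sqnorm01 (F i)) = (\<lambda>(k, a). sqnorm01 (F (k, a)))" by auto
  moreover have "\<forall>k\<in>{..<N}. (\<lambda>a. sqnorm01 (F (k, a))) summable_on Edges1"
    using assms unfolding L2sp_EdgesSum_iff by (simp add: L2sp_def)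
  ultimately show ?thesis
    by (simp add: L2norm_def EdgesSum_eq summable_on_finite_Times(2))
qed

text \<open>Acts on representatives pointwise in t, not on classes modulo null sets, so the values
  at the vertices are transformed along with the functions.\<close>

definition fiber_dft :: "complex \<Rightarrow> nat \<Rightarrow> (nat \<times> 'a \<Rightarrow> real \<Rightarrow> complex) \<Rightarrow> nat \<times> 'a \<Rightarrow> real \<Rightarrow> complex" where
  "fiber_dft w N f = (\<lambda>(k, a) t. dft w N (\<lambda>l. f (l, a) t) k)"

lemma L2sp_fiber_dft:
  assumes "F \<in> L2sp (EdgesSum N)"
  shows "fiber_dft w N F \<in> L2sp (EdgesSum N)"
  using assms unfolding L2sp_EdgesSum_iff
  by (auto simp: fiber_dft_def dft_def simp del: times_divide_eq_left intro!: L2sp_sum)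

text \<open>Parseval holds for each t separately, and integration over t commutes with the finite
  sums.\<close>

lemma sqnorm01_dft:
  assumes w: "prim_root w N" and f: "\<And>l. l < N \<Longrightarrow> L2_01 (f l)"
  shows "(\<Sum>k<N. sqnorm01 (\<lambda>t. dft w N (\<lambda>l. f l t) k)) = (\<Sum>l<N. sqnorm01 (f l))"
proof -
  have d: "L2_01 (\<lambda>t. dft w N (\<lambda>l. f l t) k)" for k
    unfolding dft_def using f by (intro L2_01_sum) auto
  have "(\<Sum>k<N. sqnorm01 (\<lambda>t. dft w N (\<lambda>l. f l t) k))
      = (LINT t|lebesgue_on {0..1}. (\<Sum>k<N. (cmod (dft w N (\<lambda>l. f l t) k))\<^sup>2))"
    unfolding sqnorm01_def by (rule Bochner_Integration.integral_sum[symmetric]) (use d in \<open>auto simp: L2_01_def\<close>)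
  also have "\<dots> = (\<Sum>l<N. sqnorm01 (f l))"
    unfolding sqnorm01_def dft_Parseval[OF w]
    by (rule Bochner_Integration.integral_sum) (use f in \<open>auto simp: L2_01_def\<close>)
  finally show ?thesis .
qed

lemma L2norm_fiber_dft:
  assumes w: "prim_root w N" and F: "F \<in> L2sp (EdgesSum N)"
  shows "L2norm (EdgesSum N) (fiber_dft w N F) = L2norm (EdgesSum N) F"
proof -
  have "(\<Sum>k<N. sqnorm01 (fiber_dft w N F (k, a))) = (\<Sum>k<N. sqnorm01 (F (k, a)))" if "a \<in> Edges1" for a
    unfolding fiber_dft_def prod.case
    by (rule sqnorm01_dft) (use w F that in \<open>auto simp: L2sp_def EdgesSum_def\<close>)
  then have "infsum (\<lambda>a. \<Sum>k<N. sqnorm01 (fiber_dft w N F (k, a))) Edges1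
      = infsum (\<lambda>a. \<Sum>k<N. sqnorm01 (F (k, a))) Edges1"
    by (rule infsum_cong)
  then show ?thesis
    using F L2sp_fiber_dft[OF F] by (simp add: L2norm_EdgesSum)
qed

lemma fiber_dft_cnj:
  "prim_root w N \<Longrightarrow> k < N \<Longrightarrow> fiber_dft w N (fiber_dft (cnj w) N F) (k, a) = F (k, a)"
  by (simp add: fiber_dft_def dft_cnj_dft)

lemma W22_fiber_dft:
  assumes "\<And>l. l < N \<Longrightarrow> W22 (F (l, a)) (D (l, a)) (D2 (l, a))"
  shows "W22 (fiber_dft w N F (k, a)) (fiber_dft w N D (k, a)) (fiber_dft w N D2 (k, a))"
  using assms by (auto simp: fiber_dft_def dft_def simp del: times_divide_eq_left intro!: W22_sum)

lemma AE_fiber_dft: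
  assumes "\<And>l. l < N \<Longrightarrow> AE t in lebesgue_on {0..1}. F (l, a) t = G (l, a) t"
  shows "AE t in lebesgue_on {0..1}. fiber_dft w N F (k, a) t = fiber_dft w N G (k, a) t"
proof -
  have "AE t in lebesgue_on {0..1}. \<forall>l\<in>{..<N}. F (l, a) t = G (l, a) t"
    using assms by (intro AE_finite_allI) auto
  then show ?thesis
    by eventually_elim (auto simp: fiber_dft_def intro: dft_cong)
qed

lemma fiber_dft_linear:
  "fiber_dft w N (\<lambda>i t. a * F i t + b * G i t) i t = a * fiber_dft w N F i t + b * fiber_dft w N G i t"
  by (cases i) (simp add: fiber_dft_def dft_linear)

lemma fiber_dft_operator:
  "fiber_dft w N (\<lambda>i t. - D2 i t + complex_of_real (q t) * y i t)
    = (\<lambda>i t. - fiber_dft w N D2 i t + complex_of_real (q t) * fiber_dft w N y i t)"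
  by (auto simp: fun_eq_iff fiber_dft_def dft_add dft_diff dft_minus dft_cmult)

section \<open>Transport of the vertex conditions in both directions\<close>

lemma graph_HkI:
  assumes "f \<in> L2sp Edges1" "D2 \<in> L2sp Edges1" "\<forall>a\<in>Edges1. W22 (f a) (D a) (D2 a)"
    "K0K1 N k f D" "aeq Edges1 g (\<lambda>a t. - D2 a t + complex_of_real (q t) * f a t)"
  shows "(f, g) \<in> graph_Hk q N k"
  using assms unfolding graph_Hk_def by blast

text \<open>The transforms of \<open>D\<close> and \<open>D2\<close> are the derivatives of the
  transform of \<open>y\<close>, because the vertex conditions are linear with coefficients
  independent of k. Different k are coupled only through the shift on the third edge.\<close>

lemma graph_H_fiber_dft:
  assumes N: "N > 0" and yz: "(y, z) \<in> graph_H q N"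
  shows "(fiber_dft (sN N) N (to_sum y), fiber_dft (sN N) N (to_sum z)) \<in> graph_sum q N"
proof -
  let ?U = "fiber_dft (sN N) N"
  note w = prim_root_sN[OF N]
  obtain D D2 where y: "y \<in> L2sp (EdgesN N)"
    and W: "\<forall>w\<in>EdgesN N. W22 (y w) (D w) (D2 w)" and D2: "D2 \<in> L2sp (EdgesN N)"
    and bc: "\<forall>n k. k < N \<longrightarrow>
           y (n,0,k) 1 = y (n,1,k) 0 \<and> y (n,1,k) 0 = y (n,2,kpred N k) 1 \<and>
           y (n+1,0,k) 0 = y (n,1,k) 1 \<and> y (n,1,k) 1 = y (n,2,k) 0 \<and>
           - D (n,0,k) 1 + D (n,1,k) 0 - D (n,2,kpred N k) 1 = 0 \<and>
           D (n+1,0,k) 0 - D (n,1,k) 1 + D (n,2,k) 0 = 0"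
    and z: "aeq (EdgesN N) z (\<lambda>w t. - D2 w t + complex_of_real (q t) * y w t)"
    using yz unfolding graph_H_def by blast
  have "((\<lambda>a. ?U (to_sum y) (k, a)), (\<lambda>a. ?U (to_sum z) (k, a))) \<in> graph_Hk q N k" if k: "k < N" for k
  proof -
    have "(\<lambda>a. ?U (to_sum y) (k, a)) \<in> L2sp Edges1" "(\<lambda>a. ?U (to_sum D2) (k, a)) \<in> L2sp Edges1"
      using y D2 k unfolding L2sp_to_sum[symmetric] by (auto intro!: L2sp_EdgesSumD L2sp_fiber_dft)
    moreover have "\<forall>a\<in>Edges1. W22 (?U (to_sum y) (k, a)) (?U (to_sum D) (k, a)) (?U (to_sum D2) (k, a))"
      using W by (auto simp: to_sum_def EdgesN_def Edges1_def intro!: W22_fiber_dft)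
    moreover have "K0K1 N k (\<lambda>a. ?U (to_sum y) (k, a)) (\<lambda>a. ?U (to_sum D) (k, a))"
    proof -
      have U: "?U (to_sum f) (k, n, j) t = dft (sN N) N (\<lambda>l. f (n, j, l) t) k" for f :: "_ \<Rightarrow> _ \<Rightarrow> _" and n j t
        by (simp add: fiber_dft_def to_sum_def)
      have shift: "sN N ^ k * dft (sN N) N (\<lambda>l. f (n, 2, l) t) k = dft (sN N) N (\<lambda>l. f (n, 2, kpred N l) t) k"
        for f :: "int \<times> nat \<times> nat \<Rightarrow> real \<Rightarrow> complex" and n t
        using dft_shift[OF w, of "\<lambda>l. f (n, 2, l) t"] by simp
      \<comment> \<open>A Kirchhoff sum is transformed as a whole: it is the transform of the zero
        sequence.\<close>
      have "- dft (sN N) N (\<lambda>l. D (n, 0, l) 1) k + dft (sN N) N (\<lambda>l. D (n, 1, l) 0) k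
          - dft (sN N) N (\<lambda>l. D (n, 2, kpred N l) 1) k = 0"
        "dft (sN N) N (\<lambda>l. D (n + 1, 0, l) 0) k - dft (sN N) N (\<lambda>l. D (n, 1, l) 1) k
          + dft (sN N) N (\<lambda>l. D (n, 2, l) 0) k = 0" for n
        unfolding dft_minus[symmetric] dft_add[symmetric] dft_diff[symmetric]
        by (rule trans[OF dft_cong dft_0[of "sN N" N k]], use bc in simp)+
      then show ?thesis
        unfolding K0K1_def U shift by (intro allI conjI dft_cong) (use bc in simp_all)
    qed
    moreover have "aeq Edges1 (\<lambda>a. ?U (to_sum z) (k, a))
        (\<lambda>a t. - ?U (to_sum D2) (k, a) t + complex_of_real (q t) * ?U (to_sum y) (k, a) t)"
      unfolding aeq_def
    proof
      fix a assume a: "a \<in> Edges1"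
      have "AE t in lebesgue_on {0..1}. ?U (to_sum z) (k, a) t
          = ?U (\<lambda>i t. - to_sum D2 i t + complex_of_real (q t) * to_sum y i t) (k, a) t"
        by (rule AE_fiber_dft) (use z a in \<open>auto simp: aeq_def to_sum_def Edges1_def EdgesN_def\<close>)
      then show "AE t in lebesgue_on {0..1}. ?U (to_sum z) (k, a) t
          = - ?U (to_sum D2) (k, a) t + complex_of_real (q t) * ?U (to_sum y) (k, a) t"
        by (simp only: fiber_dft_operator)
    qed
    ultimately show ?thesis
      by (rule graph_HkI)
  qed
  then show ?thesis by (simp add: graph_sum_def)
qed

definition of_sum :: "(nat \<times> int \<times> nat \<Rightarrow> 'a) \<Rightarrow> int \<times> nat \<times> nat \<Rightarrow> 'a" where
  "of_sum f = (\<lambda>(n, j, k). f (k, n, j))"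

lemma to_sum_of_sum [simp]: "to_sum (of_sum f) = f"
  by (auto simp: to_sum_def of_sum_def)

lemma graph_sum_fiber_dft:
  assumes N: "N > 0" and FG: "(F, G) \<in> graph_sum q N"
  shows "(of_sum (fiber_dft (cnj (sN N)) N F), of_sum (fiber_dft (cnj (sN N)) N G)) \<in> graph_H q N"
proof -
  let ?V = "fiber_dft (cnj (sN N)) N"
  note w = prim_root_sN[OF N]
  \<comment> \<open>Each H_k supplies its own derivatives; choice collects them into families over k
    that can be transformed jointly.\<close>
  have "\<forall>k. \<exists>D D2. k < N \<longrightarrow> (\<lambda>a. F (k, a)) \<in> L2sp Edges1 \<and>
      (\<forall>a\<in>Edges1. W22 (F (k, a)) (D a) (D2 a)) \<and> D2 \<in> L2sp Edges1 \<and> K0K1 N k (\<lambda>a. F (k, a)) D \<and>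
      aeq Edges1 (\<lambda>a. G (k, a)) (\<lambda>a t. - D2 a t + complex_of_real (q t) * F (k, a) t)"
    using FG by (auto simp: graph_sum_def graph_Hk_def)
  then obtain D' D2' where *: "\<forall>k<N. (\<lambda>a. F (k, a)) \<in> L2sp Edges1 \<and>
      (\<forall>a\<in>Edges1. W22 (F (k, a)) (D' k a) (D2' k a)) \<and> D2' k \<in> L2sp Edges1 \<and>
      K0K1 N k (\<lambda>a. F (k, a)) (D' k) \<and>
      aeq Edges1 (\<lambda>a. G (k, a)) (\<lambda>a t. - D2' k a t + complex_of_real (q t) * F (k, a) t)"
    unfolding choice_iff by (elim exE) blast
  define D D2 where "D = (\<lambda>(k, a). D' k a)" and "D2 = (\<lambda>(k, a). D2' k a)"
  have F: "F \<in> L2sp (EdgesSum N)" and D2: "D2 \<in> L2sp (EdgesSum N)"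
    using * by (auto simp: L2sp_EdgesSum_iff D2_def)
  have "of_sum (?V F) \<in> L2sp (EdgesN N)" "of_sum (?V D2) \<in> L2sp (EdgesN N)"
    using L2sp_fiber_dft[OF F] L2sp_fiber_dft[OF D2] by (simp_all flip: L2sp_to_sum)
  moreover have "\<forall>w\<in>EdgesN N. W22 (of_sum (?V F) w) (of_sum (?V D) w) (of_sum (?V D2) w)"
    using * by (auto simp: of_sum_def EdgesN_def Edges1_def D_def D2_def intro!: W22_fiber_dft)
  moreover have "\<forall>n k. k < N \<longrightarrow>
       of_sum (?V F) (n,0,k) 1 = of_sum (?V F) (n,1,k) 0 \<and> of_sum (?V F) (n,1,k) 0 = of_sum (?V F) (n,2,kpred N k) 1 \<and>
       of_sum (?V F) (n+1,0,k) 0 = of_sum (?V F) (n,1,k) 1 \<and> of_sum (?V F) (n,1,k) 1 = of_sum (?V F) (n,2,k) 0 \<and>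
       - of_sum (?V D) (n,0,k) 1 + of_sum (?V D) (n,1,k) 0 - of_sum (?V D) (n,2,kpred N k) 1 = 0 \<and>
       of_sum (?V D) (n+1,0,k) 0 - of_sum (?V D) (n,1,k) 1 + of_sum (?V D) (n,2,k) 0 = 0"
  proof (intro allI impI)
    fix n k assume k: "k < N"
    let ?d = "\<lambda>c. dft (cnj (sN N)) N c k"
    have V: "of_sum (?V f) (n, j, l) t = dft (cnj (sN N)) N (\<lambda>l. f (l, n, j) t) l"
      for f :: "_ \<Rightarrow> _ \<Rightarrow> _" and n j l t
      by (simp add: fiber_dft_def of_sum_def)
    have bc: "F (l,n,0) 1 = F (l,n,1) 0" "F (l,n,1) 0 = sN N ^ l * F (l,n,2) 1"
       "F (l,n+1,0) 0 = F (l,n,1) 1" "F (l,n,1) 1 = F (l,n,2) 0"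
       "- D (l,n,0) 1 + D (l,n,1) 0 - sN N ^ l * D (l,n,2) 1 = 0"
       "D (l,n+1,0) 0 - D (l,n,1) 1 + D (l,n,2) 0 = 0" if "l < N" for l
      using * that by (auto simp: K0K1_def D_def)
    have "- ?d (\<lambda>l. D (l,n,0) 1) + ?d (\<lambda>l. D (l,n,1) 0) - ?d (\<lambda>l. sN N ^ l * D (l,n,2) 1) = 0"
      "?d (\<lambda>l. D (l,n+1,0) 0) - ?d (\<lambda>l. D (l,n,1) 1) + ?d (\<lambda>l. D (l,n,2) 0) = 0"
      unfolding dft_minus[symmetric] dft_add[symmetric] dft_diff[symmetric]
      by (rule trans[OF dft_cong dft_0[of "cnj (sN N)" N k]], erule bc)+
    then show "of_sum (?V F) (n,0,k) 1 = of_sum (?V F) (n,1,k) 0 \<and> of_sum (?V F) (n,1,k) 0 = of_sum (?V F) (n,2,kpred N k) 1 \<and>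
       of_sum (?V F) (n+1,0,k) 0 = of_sum (?V F) (n,1,k) 1 \<and> of_sum (?V F) (n,1,k) 1 = of_sum (?V F) (n,2,k) 0 \<and>
       - of_sum (?V D) (n,0,k) 1 + of_sum (?V D) (n,1,k) 0 - of_sum (?V D) (n,2,kpred N k) 1 = 0 \<and>
       of_sum (?V D) (n+1,0,k) 0 - of_sum (?V D) (n,1,k) 1 + of_sum (?V D) (n,2,k) 0 = 0"
      unfolding V dft_cnj_modulate[OF w k] by (intro conjI dft_cong) (simp_all only: bc)
  qed
  moreover have "aeq (EdgesN N) (of_sum (?V G))
      (\<lambda>w t. - of_sum (?V D2) w t + complex_of_real (q t) * of_sum (?V F) w t)"
    unfolding aeq_def
  proof
    fix e assume "e \<in> EdgesN N"
    then obtain n j l where e: "e = (n, j, l)" "l < N" "(n, j) \<in> Edges1"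
      by (auto simp: EdgesN_def Edges1_def)
    have "AE t in lebesgue_on {0..1}. ?V G (l, n, j) t
        = ?V (\<lambda>i t. - D2 i t + complex_of_real (q t) * F i t) (l, n, j) t"
      by (rule AE_fiber_dft) (use * e in \<open>auto simp: aeq_def D2_def\<close>)
    then show "AE t in lebesgue_on {0..1}. of_sum (?V G) e t
        = - of_sum (?V D2) e t + complex_of_real (q t) * of_sum (?V F) e t"
      by (simp only: e of_sum_def prod.case fiber_dft_operator)
  qed
  ultimately show ?thesis
    unfolding graph_H_def by blast
qed

theorem zigzag_unitarily_equivalent:
  assumes N: "N > 0"
  shows "unitarily_equivalent (EdgesN N) (EdgesSum N) (graph_H q N) (graph_sum q N)"
  unfolding unitarily_equivalent_def
proof (rule exI[of _ "\<lambda>f. fiber_dft (sN N) N (to_sum f)"], intro conjI)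
  note w = prim_root_sN[OF N]
  let ?U = "fiber_dft (sN N) N" and ?V = "fiber_dft (cnj (sN N)) N"
  have UV: "aeq (EdgesSum N) (?U (to_sum (of_sum (?V F)))) F" for F
    by (auto simp: aeq_def EdgesSum_def fiber_dft_cnj[OF w])
  show "\<forall>f\<in>L2sp (EdgesN N). ?U (to_sum f) \<in> L2sp (EdgesSum N)"
    by (simp add: L2sp_fiber_dft L2sp_to_sum)
  show "\<forall>f\<in>L2sp (EdgesN N). \<forall>g\<in>L2sp (EdgesN N). \<forall>a b.
      aeq (EdgesSum N) (?U (to_sum (\<lambda>i t. a * f i t + b * g i t)))
        (\<lambda>j t. a * ?U (to_sum f) j t + b * ?U (to_sum g) j t)"
    by (simp add: aeq_def fiber_dft_linear[symmetric] to_sum_def case_prod_unfold)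
  show "\<forall>f\<in>L2sp (EdgesN N). L2norm (EdgesSum N) (?U (to_sum f)) = L2norm (EdgesN N) f"
    by (simp add: L2norm_fiber_dft[OF w] L2sp_to_sum L2norm_to_sum)
  show "\<forall>g\<in>L2sp (EdgesSum N). \<exists>f\<in>L2sp (EdgesN N). aeq (EdgesSum N) (?U (to_sum f)) g"
    using UV by (metis L2sp_fiber_dft L2sp_to_sum to_sum_of_sum)
  show "\<forall>(y, z)\<in>graph_H q N. \<exists>(y', z')\<in>graph_sum q N.
      aeq (EdgesSum N) y' (?U (to_sum y)) \<and> aeq (EdgesSum N) z' (?U (to_sum z))"
    by (auto simp: aeq_def intro!: bexI[OF _ graph_H_fiber_dft[OF N]])
  show "\<forall>(y', z')\<in>graph_sum q N. \<exists>(y, z)\<in>graph_H q N.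
      aeq (EdgesSum N) (?U (to_sum y)) y' \<and> aeq (EdgesSum N) (?U (to_sum z)) z'"
    by (auto intro!: bexI[OF _ graph_sum_fiber_dft[OF N]] UV simp del: to_sum_of_sum)
qed

section \<open>The Hill equation\<close>

lemma has_integral_subinterval:
  fixes f :: "real \<Rightarrow> 'a::banach"
  assumes "(f has_integral F b - F 0) {0..b}" "(f has_integral F a - F 0) {0..a}" "0 \<le> a" "a \<le> b"
  shows "(f has_integral F b - F a) {a..b}"
proof -
  have i: "f integrable_on {0..b}"
    using assms by blast
  have "integral {0..a} f + integral {a..b} f = integral {0..b} f"
    by (rule Henstock_Kurzweil_Integration.integral_combine) (use assms i in auto)
  moreover have "f integrable_on {a..b}"
    by (rule integrable_subinterval_real[OF i]) (use assms in auto)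
  ultimately show ?thesis
    using integral_unique[OF assms(1)] integral_unique[OF assms(2)]
    by (simp add: has_integral_integrable_integral algebra_simps eq_diff_eq)
qed

lemma continuous_on_indefinite_integral:
  fixes f :: "real \<Rightarrow> 'a::banach"
  assumes "\<And>t. t \<in> {0..1} \<Longrightarrow> (f has_integral F t - F 0) {0..t}"
  shows "continuous_on {0..1} F"
proof -
  have "f integrable_on {0..1}" using assms[of 1] by auto
  then have "continuous_on {0..1} (\<lambda>t. F 0 + integral {0..t} f)"
    by (intro continuous_intros indefinite_integral_continuous_1)
  then show ?thesis
    by (rule continuous_on_eq) (use integral_unique[OF assms] in auto)
qed

text \<open>The interval is cut into pieces on which \<open>\<kappa>\<close> has integral at most \<open>1/2\<close>; on each of them the
  maximum of \<open>u\<close> can be absorbed into the left-hand side.\<close>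
lemma gronwall_integrable:
  fixes \<kappa> :: "real \<Rightarrow> real"
  assumes int: "\<kappa> integrable_on {0..1}"
  obtains C where "C > 0"
    "\<And>u e t. \<lbrakk>continuous_on {0..1} u; 0 \<le> e; \<And>t. 0 \<le> u t;
        \<And>a b S. \<lbrakk>0 \<le> a; a \<le> b; b \<le> 1; \<And>s. a \<le> s \<Longrightarrow> s \<le> b \<Longrightarrow> u s \<le> S\<rbrakk>
          \<Longrightarrow> u b \<le> u a + e + S * integral {a..b} \<kappa>; t \<in> {0..1}\<rbrakk>
      \<Longrightarrow> u t \<le> C * (u 0 + e)"
proof -
  define K where "K t = integral {0..t} \<kappa>" for t
  have K: "integral {a..b} \<kappa> = K b - K a" if "0 \<le> a" "a \<le> b" "b \<le> 1" for a b
  proof -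
    have "\<kappa> integrable_on {0..b}"
      by (rule integrable_subinterval_real[OF int]) (use that in auto)
    then have "K a + integral {a..b} \<kappa> = K b"
      unfolding K_def by (intro Henstock_Kurzweil_Integration.integral_combine) (use that in auto)
    then show ?thesis by simp
  qed
  have "continuous_on {0..1} K"
    unfolding K_def by (rule indefinite_integral_continuous_1[OF int])
  then have "uniformly_continuous_on {0..1} K"
    by (intro compact_uniformly_continuous) auto
  then obtain \<delta> where \<delta>: "\<delta> > 0"
    "\<And>x y. x \<in> {0..1} \<Longrightarrow> y \<in> {0..1} \<Longrightarrow> dist y x < \<delta> \<Longrightarrow> dist (K y) (K x) < 1/2"
    unfolding uniformly_continuous_on_def by (metis half_gt_zero zero_less_one)
  obtain n where n: "n > 0" "1 / real n < \<delta>"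
    using \<delta>(1) by (metis nat_approx_posE zero_less_Suc)
  show thesis
  proof (rule that[of "3 * 2 ^ n"])
    fix u :: "real \<Rightarrow> real" and e t :: real
    assume cont: "continuous_on {0..1} u" and e: "0 \<le> e" and u0: "\<And>t. 0 \<le> u t"
      and step: "\<And>a b S. \<lbrakk>0 \<le> a; a \<le> b; b \<le> 1; \<And>s. a \<le> s \<Longrightarrow> s \<le> b \<Longrightarrow> u s \<le> S\<rbrakk>
          \<Longrightarrow> u b \<le> u a + e + S * integral {a..b} \<kappa>"
      and t: "t \<in> {0..1}"
    \<comment> \<open>The factors solve c 0 = 1, c (i + 1) = 2 * c i + 2: absorbing half of the
      maximum doubles the bound, and each piece adds e before the doubling.\<close>
    have ind: "i \<le> n \<Longrightarrow> (\<forall>t\<in>{0..real i / real n}. u t \<le> (3 * 2 ^ i - 2) * (u 0 + e))" for i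
    proof (induction i)
      case 0
      then show ?case using e by auto
    next
      case (Suc i)
      let ?a = "real i / real n" and ?c = "real (Suc i) / real n"
      have ac: "0 \<le> ?a" "?a \<le> ?c" "?c \<le> 1" "?c - ?a < \<delta>"
        using Suc.prems n by (auto simp: field_simps)
      have "continuous_on {?a..?c} u"
        by (rule continuous_on_subset[OF cont]) (use ac in auto)
      then obtain x where x: "x \<in> {?a..?c}" "\<And>y. y \<in> {?a..?c} \<Longrightarrow> u y \<le> u x"
        using continuous_attains_sup[of "{?a..?c}" u] ac by auto
      have "x \<in> {0..1}" "dist x ?a < \<delta>"
        using x(1) ac unfolding dist_real_def atLeastAtMost_iff by linarith+
      then have "dist (K x) (K ?a) < 1/2"
        using \<delta>(2)[of ?a x] ac by simp
      then have "integral {?a..x} \<kappa> \<le> 1/2"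
        using K[of ?a x] x(1) ac by (auto simp: dist_real_def abs_if split: if_splits)
      then have "u x * integral {?a..x} \<kappa> \<le> u x / 2"
        using u0[of x] mult_left_mono[of _ "1/2" "u x"] by simp
      moreover have "u x \<le> u ?a + e + u x * integral {?a..x} \<kappa>"
        by (rule step) (use x ac in auto)
      moreover have "u ?a \<le> (3 * 2 ^ i - 2) * (u 0 + e)"
        using Suc ac by auto
      moreover have "v \<le> 2 * (c + e)" if "p \<le> v / 2" "v \<le> w + e + p" "w \<le> c" for p v w c :: real
        using that by simp
      ultimately have "u x \<le> 2 * ((3 * 2 ^ i - 2) * (u 0 + e) + e)"
        by blast
      also have "\<dots> \<le> (3 * 2 ^ Suc i - 2) * (u 0 + e)"
        using u0[of 0] by (simp add: algebra_simps)
      finally have ux: "u x \<le> (3 * 2 ^ Suc i - 2) * (u 0 + e)" .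
      show ?case
      proof
        fix t assume t: "t \<in> {0..?c}"
        show "u t \<le> (3 * 2 ^ Suc i - 2) * (u 0 + e)"
        proof (cases "t \<le> ?a")
          case True
          then have "u t \<le> (3 * 2 ^ i - 2) * (u 0 + e)" using Suc t by auto
          also have "\<dots> \<le> (3 * 2 ^ Suc i - 2) * (u 0 + e)"
            using u0[of 0] e by (intro mult_right_mono) auto
          finally show ?thesis .
        next
          case False
          then show ?thesis using x(2)[of t] ux t by auto
        qed
      qed
    qed
    have "u t \<le> (3 * 2 ^ n - 2) * (u 0 + e)"
      using ind[of n] t n by auto
    also have "\<dots> \<le> 3 * 2 ^ n * (u 0 + e)"
      using u0[of 0] e by (intro mult_right_mono) auto
    finally show "u t \<le> 3 * 2 ^ n * (u 0 + e)" .
  qed auto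
qed

text \<open>A substitute for the product rule for the Wronskian: for \<open>q\<close> in \<open>L\<^sup>2\<close> the derivative of a solution
  is merely absolutely continuous.\<close>
lemma eq_of_small_increments:
  fixes W :: "real \<Rightarrow> 'a::real_normed_vector" and \<kappa> :: "real \<Rightarrow> real"
  assumes int: "\<kappa> integrable_on {0..1}"
    and small: "\<And>\<epsilon>. \<epsilon> > 0 \<Longrightarrow> \<exists>\<delta>>0. \<forall>a b. 0 \<le> a \<and> a \<le> b \<and> b \<le> 1 \<and> b - a < \<delta>
        \<longrightarrow> norm (W b - W a) \<le> \<epsilon> * integral {a..b} \<kappa>"
  shows "W 1 = W 0"
proof -
  have bound: "norm (W 1 - W 0) \<le> \<epsilon> * integral {0..1} \<kappa>" if \<epsilon>: "\<epsilon> > 0" for \<epsilon>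
  proof -
    obtain \<delta> where \<delta>: "\<delta> > 0" "\<And>a b. 0 \<le> a \<Longrightarrow> a \<le> b \<Longrightarrow> b \<le> 1 \<Longrightarrow> b - a < \<delta>
        \<Longrightarrow> norm (W b - W a) \<le> \<epsilon> * integral {a..b} \<kappa>"
      using small[OF \<epsilon>] by blast
    obtain n where n: "n > 0" "1 / real n < \<delta>"
      using \<delta>(1) by (metis nat_approx_posE zero_less_Suc)
    \<comment> \<open>Telescoping over a grid finer than \<open>\<delta>\<close>; the bounds add up
      because the integral of \<open>\<kappa>\<close> is additive over intervals.\<close>
    have "i \<le> n \<Longrightarrow> norm (W (real i / real n) - W 0) \<le> \<epsilon> * integral {0..real i / real n} \<kappa>" for i
    proof (induction i)
      case 0
      then show ?case by simp
    next
      case (Suc i)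
      let ?a = "real i / real n" and ?c = "real (Suc i) / real n"
      have ac: "0 \<le> ?a" "?a \<le> ?c" "?c \<le> 1" "?c - ?a < \<delta>"
        using Suc.prems n by (auto simp: field_simps)
      have "integral {0..?a} \<kappa> + integral {?a..?c} \<kappa> = integral {0..?c} \<kappa>"
        by (intro Henstock_Kurzweil_Integration.integral_combine integrable_subinterval_real[OF int])
           (use ac in auto)
      then have "\<epsilon> * integral {0..?c} \<kappa> = \<epsilon> * integral {0..?a} \<kappa> + \<epsilon> * integral {?a..?c} \<kappa>"
        by (metis distrib_left)
      moreover have "norm (W ?c - W 0) \<le> norm (W ?c - W ?a) + norm (W ?a - W 0)"
        using norm_triangle_ineq[of "W ?c - W ?a" "W ?a - W 0"] by simp
      moreover have "norm (W ?a - W 0) \<le> \<epsilon> * integral {0..?a} \<kappa>"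
        using Suc by simp
      ultimately show ?case
        using \<delta>(2)[OF ac] by linarith
    qed
    from this[of n] n show ?thesis by simp
  qed
  have "norm (W 1 - W 0) \<le> 0"
  proof (rule field_le_epsilon)
    fix e :: real assume e: "e > 0"
    let ?I = "integral {0..1} \<kappa>"
    have "norm (W 1 - W 0) \<le> e / (\<bar>?I\<bar> + 1) * ?I"
      using e by (intro bound) (simp add: add_nonneg_pos)
    also have "\<dots> \<le> e" using e by (simp add: field_simps abs_if)
    finally show "norm (W 1 - W 0) \<le> 0 + e" by simp
  qed
  then show ?thesis by simp
qed

section \<open>Solutions of the Hill equation: a priori bound, uniqueness, Wronskian\<close>

text \<open>The inhomogeneity is needed because a difference quotient in the spectral parameter of solutions
  of \<open>-g'' + q g = \<mu> g\<close> solves \<open>-g'' + q g = \<mu> g + h\<close>.\<close>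
definition hill_sol_inhom ::
  "(real \<Rightarrow> real) \<Rightarrow> complex \<Rightarrow> (real \<Rightarrow> complex) \<Rightarrow> (real \<Rightarrow> complex) \<Rightarrow> (real \<Rightarrow> complex) \<Rightarrow> bool" where
  "hill_sol_inhom q mu h g g' \<longleftrightarrow> (\<forall>t\<in>{0..1}. (g' has_integral (g t - g 0)) {0..t} \<and>
     ((\<lambda>x. (complex_of_real (q x) - mu) * g x - h x) has_integral (g' t - g' 0)) {0..t})"

lemma hill_sol_inhom_0: "hill_sol_inhom q mu (\<lambda>_. 0) g g' \<longleftrightarrow> hill_sol q mu g g'"
  by (simp add: hill_sol_inhom_def hill_sol_def)

text \<open>Moves a change of spectral parameter into the inhomogeneity, so that the solutions for
  all lam near mu are controlled by one bound at mu.\<close>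

lemma hill_sol_inhom_shift:
  assumes "hill_sol q lam g g'"
  shows "hill_sol_inhom q mu (\<lambda>x. (lam - mu) * g x) g g'"
  using assms by (simp add: hill_sol_inhom_def hill_sol_def algebra_simps)

lemma hill_sol_inhom_diff:
  assumes "hill_sol_inhom q mu h f f'" "hill_sol_inhom q mu k g g'"
  shows "hill_sol_inhom q mu (\<lambda>x. h x - k x) (\<lambda>x. f x - g x) (\<lambda>x. f' x - g' x)"
  unfolding hill_sol_inhom_def
proof (intro ballI conjI)
  fix t :: real assume t: "t \<in> {0..1}"
  have "((\<lambda>x. f' x - g' x) has_integral (f t - f 0) - (g t - g 0)) {0..t}"
    by (rule has_integral_diff) (use assms t in \<open>auto simp: hill_sol_inhom_def\<close>)
  then show "((\<lambda>x. f' x - g' x) has_integral f t - g t - (f 0 - g 0)) {0..t}"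
    by (simp add: algebra_simps)
  have "((\<lambda>x. ((complex_of_real (q x) - mu) * f x - h x) - ((complex_of_real (q x) - mu) * g x - k x))
      has_integral (f' t - f' 0) - (g' t - g' 0)) {0..t}"
    by (rule has_integral_diff) (use assms t in \<open>auto simp: hill_sol_inhom_def\<close>)
  then show "((\<lambda>x. (complex_of_real (q x) - mu) * (f x - g x) - (h x - k x))
      has_integral f' t - g' t - (f' 0 - g' 0)) {0..t}"
    by (simp add: algebra_simps)
qed

lemma hill_sol_inhom_cmult:
  assumes "hill_sol_inhom q mu h f f'"
  shows "hill_sol_inhom q mu (\<lambda>x. c * h x) (\<lambda>x. c * f x) (\<lambda>x. c * f' x)"
  unfolding hill_sol_inhom_def
proof (intro ballI conjI)
  fix t :: real assume t: "t \<in> {0..1}"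
  have "((\<lambda>x. c * f' x) has_integral c * (f t - f 0)) {0..t}"
    using assms t by (intro has_integral_mult_right) (auto simp: hill_sol_inhom_def)
  then show "((\<lambda>x. c * f' x) has_integral c * f t - c * f 0) {0..t}"
    by (simp add: algebra_simps)
  have "((\<lambda>x. c * ((complex_of_real (q x) - mu) * f x - h x)) has_integral c * (f' t - f' 0)) {0..t}"
    using assms t by (intro has_integral_mult_right) (auto simp: hill_sol_inhom_def)
  then show "((\<lambda>x. (complex_of_real (q x) - mu) * (c * f x) - c * h x) has_integral c * f' t - c * f' 0) {0..t}"
    by (simp add: algebra_simps)
qed

lemma hill_sol_lincomb:
  assumes "hill_sol q mu f f'" "hill_sol q mu g g'"
  shows "hill_sol q mu (\<lambda>x. a * f x + b * g x) (\<lambda>x. a * f' x + b * g' x)"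
  using hill_sol_inhom_diff[OF hill_sol_inhom_cmult[of _ _ _ _ _ a] hill_sol_inhom_cmult[of _ _ _ _ _ "-b"],
      of q mu "\<lambda>_. 0" f f' "\<lambda>_. 0" g g'] assms
  by (simp add: hill_sol_inhom_0)

lemma hill_sol_inhom_continuous:
  assumes "hill_sol_inhom q mu h g g'"
  shows "continuous_on {0..1} g" "continuous_on {0..1} g'"
  by (rule continuous_on_indefinite_integral; use assms in \<open>auto simp: hill_sol_inhom_def\<close>)+

lemma hill_sol_continuous:
  assumes "hill_sol q mu g g'"
  shows "continuous_on {0..1} g" "continuous_on {0..1} g'"
  using hill_sol_inhom_continuous[of q mu "\<lambda>_. 0"] assms by (auto simp: hill_sol_inhom_0)

lemma hill_sol_inhom_increment:
  assumes "hill_sol_inhom q mu h g g'" "0 \<le> a" "a \<le> b" "b \<le> 1"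
  shows "(g' has_integral g b - g a) {a..b}"
    and "((\<lambda>x. (complex_of_real (q x) - mu) * g x - h x) has_integral g' b - g' a) {a..b}"
  by (rule has_integral_subinterval; use assms in \<open>auto simp: hill_sol_inhom_def\<close>)+

text \<open>This is the Gronwall kernel for |g| + |g'|: the summand 1 accounts for the growth of g
  through g', the summand |q - mu| for that of g' through g.\<close>

lemma integrable_norm_potential:
  fixes q :: "real \<Rightarrow> real"
  assumes "integrable (lebesgue_on {0..1}) q"
  shows "(\<lambda>t. 1 + cmod (complex_of_real (q t) - mu)) integrable_on {0..1}"
proof -
  have "integrable (lebesgue_on {0..1}) (\<lambda>t. cmod (complex_of_real (q t) - mu))"
    using assms
    by (intro integrable_norm Bochner_Integration.integrable_diff integrable_of_real
        finite_measure.integrable_const finite_measure_lebesgue_on) auto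
  then have "(\<lambda>t. cmod (complex_of_real (q t) - mu)) integrable_on {0..1}"
    by (rule integrable_on_lebesgue_on) simp
  then show ?thesis by (intro integrable_add) auto
qed

text \<open>The order of quantifiers matters: C depends on q and mu only and serves all solutions
  and all inhomogeneities at once.\<close>

lemma hill_sol_inhom_bound:
  assumes q: "integrable (lebesgue_on {0..1}) q"
  obtains C where "C > 0"
    "\<And>h g g' e t. \<lbrakk>hill_sol_inhom q mu h g g'; \<And>t. t \<in> {0..1} \<Longrightarrow> cmod (h t) \<le> e; t \<in> {0..1}\<rbrakk>
      \<Longrightarrow> cmod (g t) + cmod (g' t) \<le> C * (cmod (g 0) + cmod (g' 0) + e)"
proof -
  let ?\<kappa> = "\<lambda>t. 1 + cmod (complex_of_real (q t) - mu)"
  note \<kappa> = integrable_norm_potential[OF q, of mu]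
  obtain C where C: "C > 0"
    "\<And>u e t. \<lbrakk>continuous_on {0..1} u; 0 \<le> e; \<And>t. 0 \<le> u t;
        \<And>a b S. \<lbrakk>0 \<le> a; a \<le> b; b \<le> 1; \<And>s. a \<le> s \<Longrightarrow> s \<le> b \<Longrightarrow> u s \<le> S\<rbrakk>
          \<Longrightarrow> u b \<le> u a + e + S * integral {a..b} ?\<kappa>; t \<in> {0..1}\<rbrakk>
      \<Longrightarrow> u t \<le> C * (u 0 + e)"
    using gronwall_integrable[OF \<kappa>] by metis
  show thesis
  proof (rule that[OF C(1)])
    fix h g g' and e t :: real
    assume sol: "hill_sol_inhom q mu h g g'" and h: "\<And>t. t \<in> {0..1} \<Longrightarrow> cmod (h t) \<le> e"
      and t: "t \<in> {0..1}"
    let ?u = "\<lambda>t. cmod (g t) + cmod (g' t)"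
    have e: "0 \<le> e" using order_trans[OF norm_ge_zero h[of 0]] by simp
    show "?u t \<le> C * (?u 0 + e)"
    proof (rule C(2)[OF _ e _ _ t])
      show "continuous_on {0..1} ?u"
        using hill_sol_inhom_continuous[OF sol] by (intro continuous_intros)
      fix a b S :: real
      assume ab: "0 \<le> a" "a \<le> b" "b \<le> 1" and S: "\<And>s. a \<le> s \<Longrightarrow> s \<le> b \<Longrightarrow> ?u s \<le> S"
      have Sg: "cmod (g s) \<le> S" "cmod (g' s) \<le> S" if "s \<in> {a..b}" for s
      proof -
        have "?u s \<le> S" using S that by auto
        then show "cmod (g s) \<le> S" "cmod (g' s) \<le> S"
          using norm_ge_zero[of "g s"] norm_ge_zero[of "g' s"] by linarith+
      qed
      note inc = hill_sol_inhom_increment[OF sol ab]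
      have \<kappa>': "?\<kappa> integrable_on {a..b}" "(\<lambda>t. cmod (complex_of_real (q t) - mu)) integrable_on {a..b}"
      proof -
        show 1: "?\<kappa> integrable_on {a..b}"
          by (rule integrable_subinterval_real[OF \<kappa>]) (use ab in auto)
        show "(\<lambda>t. cmod (complex_of_real (q t) - mu)) integrable_on {a..b}"
          using integrable_diff[OF 1 integrable_const_ivl[of 1 a b]] by simp
      qed
      have "cmod (g b - g a) \<le> integral {a..b} (\<lambda>_. S)"
      proof -
        have "cmod (integral {a..b} g') \<le> integral {a..b} (\<lambda>_. S)"
        proof (rule integral_norm_bound_integral)
          fix s assume "s \<in> {a..b}"
          then show "cmod (g' s) \<le> S" by (rule Sg)
        qed (use inc in auto)
        then show ?thesis using integral_unique[OF inc(1)] by simp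
      qed
      moreover have "cmod (g' b - g' a) \<le> integral {a..b} (\<lambda>t. S * cmod (complex_of_real (q t) - mu) + e)"
      proof -
        have "cmod (integral {a..b} (\<lambda>x. (complex_of_real (q x) - mu) * g x - h x))
            \<le> integral {a..b} (\<lambda>t. S * cmod (complex_of_real (q t) - mu) + e)"
        proof (rule integral_norm_bound_integral)
          show "(\<lambda>x. (complex_of_real (q x) - mu) * g x - h x) integrable_on {a..b}"
            using inc(2) by auto
          show "(\<lambda>t. S * cmod (complex_of_real (q t) - mu) + e) integrable_on {a..b}"
            using \<kappa>'(2) by (intro integrable_add integrable_on_mult_right) auto
          fix s assume s: "s \<in> {a..b}"
          have "cmod ((complex_of_real (q s) - mu) * g s - h s)
              \<le> cmod (complex_of_real (q s) - mu) * cmod (g s) + cmod (h s)"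
            by (metis norm_mult norm_triangle_ineq4)
          also have "cmod (complex_of_real (q s) - mu) * cmod (g s) \<le> cmod (complex_of_real (q s) - mu) * S"
            using s by (intro mult_left_mono Sg) auto
          also have "cmod (h s) \<le> e" using s ab by (intro h) auto
          finally show "cmod ((complex_of_real (q s) - mu) * g s - h s)
              \<le> S * cmod (complex_of_real (q s) - mu) + e"
            by (simp add: mult.commute)
        qed
        then show ?thesis using integral_unique[OF inc(2)] by simp
      qed
      moreover have "integral {a..b} (\<lambda>_. S) + integral {a..b} (\<lambda>t. S * cmod (complex_of_real (q t) - mu) + e)
          = S * integral {a..b} ?\<kappa> + e * (b - a)"
      proof -
        let ?m = "\<lambda>t. cmod (complex_of_real (q t) - mu)"
        note m = integrable_integral[OF \<kappa>'(2)]
        have i1: "integral {a..b} (\<lambda>t. S * ?m t + e) = S * integral {a..b} ?m + (b - a) * e"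
          by (rule integral_unique)
             (use ab has_integral_add[OF has_integral_mult_right[OF m, of S] has_integral_const_real[of e a b]] in simp)
        have i2: "integral {a..b} ?\<kappa> = (b - a) + integral {a..b} ?m"
          by (rule integral_unique)
             (use ab has_integral_add[OF has_integral_const_real[of 1 a b] m] in simp)
        show ?thesis
          unfolding i1 i2 using ab by (simp add: algebra_simps)
      qed
      \<comment> \<open>The inhomogeneity contributes e times the length of the piece, and that
        length is at most 1.\<close>
      moreover have "e * (b - a) \<le> e * 1"
        using e ab by (intro mult_left_mono) auto
      moreover have "cmod (g b) \<le> cmod (g b - g a) + cmod (g a)" "cmod (g' b) \<le> cmod (g' b - g' a) + cmod (g' a)"
        using norm_triangle_ineq[of "g b - g a" "g a"] norm_triangle_ineq[of "g' b - g' a" "g' a"] by simp_all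
      ultimately show "?u b \<le> ?u a + e + S * integral {a..b} ?\<kappa>"
        by linarith
    qed auto
  qed
qed

lemma hill_sol_unique:
  assumes q: "integrable (lebesgue_on {0..1}) q"
    and sol: "hill_sol q mu f f'" "hill_sol q mu g g'" "f 0 = g 0" "f' 0 = g' 0" and t: "t \<in> {0..1}"
  shows "f t = g t" "f' t = g' t"
proof -
  obtain C where C: "C > 0"
    "\<And>h g g' e t. \<lbrakk>hill_sol_inhom q mu h g g'; \<And>t. t \<in> {0..1} \<Longrightarrow> cmod (h t) \<le> e; t \<in> {0..1}\<rbrakk>
      \<Longrightarrow> cmod (g t) + cmod (g' t) \<le> C * (cmod (g 0) + cmod (g' 0) + e)"
    using hill_sol_inhom_bound[OF q, of mu] by metis
  have "hill_sol_inhom q mu (\<lambda>x. 0 - 0) (\<lambda>x. f x - g x) (\<lambda>x. f' x - g' x)"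
    by (rule hill_sol_inhom_diff) (use sol in \<open>simp_all add: hill_sol_inhom_0\<close>)
  from C(2)[OF this _ t, of 0] have "cmod (f t - g t) + cmod (f' t - g' t) \<le> 0"
    using sol by simp
  then show "f t = g t" "f' t = g' t"
    using norm_ge_zero[of "f t - g t"] norm_ge_zero[of "f' t - g' t"]
    by (simp_all add: add_nonneg_eq_0_iff order_antisym_conv)
qed

lemma hill_sol_wronskian:
  assumes q: "integrable (lebesgue_on {0..1}) q"
    and f: "hill_sol q mu f f'" and g: "hill_sol q mu g g'"
  shows "g 1 * f' 1 - g' 1 * f 1 = g 0 * f' 0 - g' 0 * f 0"
proof (rule eq_of_small_increments[OF integrable_norm_potential[OF q, of mu], where W = "\<lambda>t. g t * f' t - g' t * f t"])
  let ?\<kappa> = "\<lambda>t. 1 + cmod (complex_of_real (q t) - mu)"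
  note cont = hill_sol_continuous[OF f] hill_sol_continuous[OF g]
  have bdd: "\<exists>B. \<forall>t\<in>{0..1}. cmod (k t) \<le> B" if "continuous_on {0..1} k" for k :: "real \<Rightarrow> complex"
    using compact_imp_bounded[OF compact_continuous_image[OF that]] by (auto simp: bounded_iff)
  obtain B1 B2 B3 B4 where "\<forall>t\<in>{0..1}. cmod (f t) \<le> B1" "\<forall>t\<in>{0..1}. cmod (f' t) \<le> B2"
      "\<forall>t\<in>{0..1}. cmod (g t) \<le> B3" "\<forall>t\<in>{0..1}. cmod (g' t) \<le> B4"
    using cont[THEN bdd] by blast
  then obtain B where B: "\<And>t. t \<in> {0..1} \<Longrightarrow> cmod (f t) \<le> B" "\<And>t. t \<in> {0..1} \<Longrightarrow> cmod (f' t) \<le> B"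
      "\<And>t. t \<in> {0..1} \<Longrightarrow> cmod (g t) \<le> B" "\<And>t. t \<in> {0..1} \<Longrightarrow> cmod (g' t) \<le> B" and B0: "B > 0"
    by (intro that[of "\<bar>B1\<bar> + \<bar>B2\<bar> + \<bar>B3\<bar> + \<bar>B4\<bar> + 1"]) fastforce+
  fix \<epsilon> :: real assume \<epsilon>: "\<epsilon> > 0"
  \<comment> \<open>In \<open>cross\<close> the error B * \<eta> occurs twice and must add up to
    \<open>\<epsilon>\<close>.\<close>
  define \<eta> where "\<eta> = \<epsilon> / (2 * B)"
  have \<eta>: "\<eta> > 0" "2 * B * \<eta> = \<epsilon>" using B0 \<epsilon> by (auto simp: \<eta>_def)
  have unif: "\<exists>\<delta>>0. \<forall>x\<in>{0..1}. \<forall>y\<in>{0..1}. \<bar>x - y\<bar> < \<delta> \<longrightarrow> cmod (k x - k y) \<le> \<eta>"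
    if "continuous_on {0..1} k" for k :: "real \<Rightarrow> complex"
  proof -
    have "uniformly_continuous_on {0..1} k"
      using that by (intro compact_uniformly_continuous) auto
    then show ?thesis
      using \<eta>(1) unfolding uniformly_continuous_on_def dist_norm real_norm_def by (meson less_imp_le)
  qed
  obtain d1 where d1: "d1 > 0"
    "\<And>x y. x\<in>{0..1} \<Longrightarrow> y\<in>{0..1} \<Longrightarrow> \<bar>x - y\<bar> < d1 \<Longrightarrow> cmod (f x - f y) \<le> \<eta>"
    using unif[OF cont(1)] by blast
  obtain d2 where d2: "d2 > 0"
    "\<And>x y. x\<in>{0..1} \<Longrightarrow> y\<in>{0..1} \<Longrightarrow> \<bar>x - y\<bar> < d2 \<Longrightarrow> cmod (f' x - f' y) \<le> \<eta>"
    using unif[OF cont(2)] by blast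
  obtain d3 where d3: "d3 > 0"
    "\<And>x y. x\<in>{0..1} \<Longrightarrow> y\<in>{0..1} \<Longrightarrow> \<bar>x - y\<bar> < d3 \<Longrightarrow> cmod (g x - g y) \<le> \<eta>"
    using unif[OF cont(3)] by blast
  obtain d4 where d4: "d4 > 0"
    "\<And>x y. x\<in>{0..1} \<Longrightarrow> y\<in>{0..1} \<Longrightarrow> \<bar>x - y\<bar> < d4 \<Longrightarrow> cmod (g' x - g' y) \<le> \<eta>"
    using unif[OF cont(4)] by blast
  define \<delta> where "\<delta> = min (min d1 d2) (min d3 d4)"
  have cross: "cmod (x * y' - y * x') \<le> \<epsilon>"
    if "cmod x \<le> B" "cmod y \<le> B" "cmod (x - x') \<le> \<eta>" "cmod (y - y') \<le> \<eta>" for x y x' y' :: complex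
  proof -
    have "x * y' - y * x' = y * (x - x') - x * (y - y')" by (simp add: algebra_simps)
    also have "cmod \<dots> \<le> cmod y * cmod (x - x') + cmod x * cmod (y - y')"
      by (metis norm_mult norm_triangle_ineq4)
    also have "\<dots> \<le> B * \<eta> + B * \<eta>"
      using that B0 by (intro add_mono mult_mono) auto
    finally show ?thesis using \<eta>(2) by simp
  qed
  show "\<exists>\<delta>>0. \<forall>a b. 0 \<le> a \<and> a \<le> b \<and> b \<le> 1 \<and> b - a < \<delta>
      \<longrightarrow> norm ((g b * f' b - g' b * f b) - (g a * f' a - g' a * f a)) \<le> \<epsilon> * integral {a..b} ?\<kappa>"
  proof (intro exI[of _ \<delta>] conjI allI impI)
    show "\<delta> > 0" using d1 d2 d3 d4 by (auto simp: \<delta>_def)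
    fix a b :: real assume "0 \<le> a \<and> a \<le> b \<and> b \<le> 1 \<and> b - a < \<delta>"
    then have ab: "0 \<le> a" "a \<le> b" "b \<le> 1" "b - a < \<delta>" by auto
    note incf = hill_sol_inhom_increment[OF f[folded hill_sol_inhom_0] ab(1-3)]
    note incg = hill_sol_inhom_increment[OF g[folded hill_sol_inhom_0] ab(1-3)]
    let ?p = "\<lambda>x. complex_of_real (q x) - mu"
    let ?k = "\<lambda>x. (g b * (?p x * f x - 0) - f b * (?p x * g x - 0)) + (f' a * g' x - g' a * f' x)"
    have "(?k has_integral (g b * (f' b - f' a) - f b * (g' b - g' a)) + (f' a * (g b - g a) - g' a * (f b - f a))) {a..b}"
      by (rule has_integral_add[OF has_integral_diff[OF
            has_integral_mult_right[OF incf(2)] has_integral_mult_right[OF incg(2)]]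
          has_integral_diff[OF has_integral_mult_right[OF incg(1)] has_integral_mult_right[OF incf(1)]]])
    then have k: "(?k has_integral (g b * f' b - g' b * f b) - (g a * f' a - g' a * f a)) {a..b}"
      by (simp add: algebra_simps)
    have "cmod (integral {a..b} ?k) \<le> integral {a..b} (\<lambda>x. \<epsilon> * ?\<kappa> x)"
    proof (rule integral_norm_bound_integral)
      show "?k integrable_on {a..b}" using k by blast
      have "?\<kappa> integrable_on {a..b}"
        by (rule integrable_subinterval_real[OF integrable_norm_potential[OF q]]) (use ab in auto)
      then show "(\<lambda>x. \<epsilon> * ?\<kappa> x) integrable_on {a..b}"
        by (rule integrable_on_mult_right)
      fix x assume x: "x \<in> {a..b}"
      have I: "a \<in> {0..1}" "b \<in> {0..1}" "x \<in> {0..1}" "\<bar>b - x\<bar> < \<delta>" "\<bar>a - x\<bar> < \<delta>" using x ab by auto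
      have "?k x = ?p x * (g b * f x - f b * g x) + (f' a * g' x - g' a * f' x)"
        by (simp add: algebra_simps)
      also have "cmod \<dots> \<le> cmod (?p x) * cmod (g b * f x - f b * g x) + cmod (f' a * g' x - g' a * f' x)"
        by (metis norm_mult norm_triangle_ineq)
      also have "\<dots> \<le> cmod (?p x) * \<epsilon> + \<epsilon>"
        by (intro add_mono mult_left_mono cross B d1(2) d2(2) d3(2) d4(2) I norm_ge_zero) (use I in \<open>auto simp: \<delta>_def\<close>)
      finally show "cmod (?k x) \<le> \<epsilon> * ?\<kappa> x" by (simp add: algebra_simps)
    qed
    then show "norm ((g b * f' b - g' b * f b) - (g a * f' a - g' a * f a)) \<le> \<epsilon> * integral {a..b} ?\<kappa>"
      using integral_unique[OF k] by simp
  qed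
qed

section \<open>Holomorphy in the spectral parameter\<close>

text \<open>A Cauchy criterion with a rate. The limit L is found along one sequence tending to mu;
  letting one of the two points run along it bounds z - L at every other point.\<close>

lemma tendsto_of_two_point_bound:
  fixes z :: "complex \<Rightarrow> complex"
  assumes r: "r > 0"
    and bd: "\<And>x y. \<lbrakk>x \<noteq> mu; y \<noteq> mu; cmod (x - mu) < r; cmod (y - mu) < r\<rbrakk>
      \<Longrightarrow> cmod (z x - z y) \<le> K * (cmod (x - mu) + cmod (y - mu))"
  shows "\<exists>L. (z \<longlongrightarrow> L) (at mu)"
proof -
  \<comment> \<open>The shift by 2 keeps every point strictly inside radius r, including the one for
    n = 0.\<close>
  define x where "x n = mu + complex_of_real (r / (real n + 2))" for n
  have x: "x n \<noteq> mu" "cmod (x n - mu) = r / (real n + 2)" "cmod (x n - mu) < r" for n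
    using r by (auto simp: x_def norm_divide divide_less_eq distrib_left add_pos_nonneg
        simp flip: of_real_add of_real_divide of_nat_add)
  have lim: "(\<lambda>n. cmod (x n - mu)) \<longlonglongrightarrow> 0"
    unfolding x(2) by real_asymp
  have K: "0 \<le> K"
  proof -
    have "0 \<le> K * (cmod (x 0 - mu) + cmod (x 0 - mu))"
      using bd[OF x(1) x(1) x(3) x(3), of 0 0] by simp
    moreover have "cmod (x 0 - mu) > 0" using x(1)[of 0] by simp
    ultimately show ?thesis by (simp add: zero_le_mult_iff)
  qed
  have "Cauchy (\<lambda>n. z (x n))"
  proof (rule CauchyI)
    fix e :: real assume e: "e > 0"
    define \<eta> where "\<eta> = e / (2 * (K + 1))"
    have \<eta>: "\<eta> > 0" "2 * (K + 1) * \<eta> = e" using K e by (auto simp: \<eta>_def)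
    have "eventually (\<lambda>n. cmod (x n - mu) < \<eta>) sequentially"
      using \<eta> by (intro order_tendstoD(2)[OF lim]) auto
    then obtain M where M: "\<And>n. n \<ge> M \<Longrightarrow> cmod (x n - mu) < \<eta>"
      by (auto simp: eventually_sequentially)
    show "\<exists>M. \<forall>m\<ge>M. \<forall>n\<ge>M. cmod (z (x m) - z (x n)) < e"
    proof (intro exI[of _ M] allI impI)
      fix m n assume mn: "M \<le> m" "M \<le> n"
      have "cmod (z (x m) - z (x n)) \<le> K * (cmod (x m - mu) + cmod (x n - mu))"
        by (intro bd x)
      also have "\<dots> \<le> (K + 1) * (cmod (x m - mu) + cmod (x n - mu))"
        by (intro mult_right_mono) auto
      also have "\<dots> < (K + 1) * (\<eta> + \<eta>)"
        using K M[OF mn(1)] M[OF mn(2)] by (intro mult_strict_left_mono) auto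
      also have "\<dots> = e" using \<eta>(2) by (simp add: algebra_simps)
      finally show "cmod (z (x m) - z (x n)) < e" .
    qed
  qed
  then obtain L where L: "(\<lambda>n. z (x n)) \<longlonglongrightarrow> L"
    using Cauchy_convergent_iff convergent_def by blast
  have bound: "cmod (z y - L) \<le> K * cmod (y - mu)" if y: "y \<noteq> mu" "cmod (y - mu) < r" for y
  proof (rule LIMSEQ_le)
    show "(\<lambda>n. cmod (z y - z (x n))) \<longlonglongrightarrow> cmod (z y - L)"
      by (intro tendsto_intros L)
    have "(\<lambda>n. K * (cmod (y - mu) + cmod (x n - mu))) \<longlonglongrightarrow> K * (cmod (y - mu) + 0)"
      by (intro tendsto_intros lim)
    then show "(\<lambda>n. K * (cmod (y - mu) + cmod (x n - mu))) \<longlonglongrightarrow> K * cmod (y - mu)" by simp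
    show "\<exists>N. \<forall>n\<ge>N. cmod (z y - z (x n)) \<le> K * (cmod (y - mu) + cmod (x n - mu))"
      by (intro exI[of _ 0] allI impI bd y x)
  qed
  have "((\<lambda>y. z y - L) \<longlongrightarrow> 0) (at mu)"
  proof (rule Lim_null_comparison)
    show "eventually (\<lambda>y. norm (z y - L) \<le> K * cmod (y - mu)) (at mu)"
      unfolding eventually_at using r bound by (auto simp: dist_norm)
    have "((\<lambda>y. K * cmod (y - mu)) \<longlongrightarrow> K * cmod (mu - mu)) (at mu)"
      by (intro tendsto_intros)
    then show "((\<lambda>y. K * cmod (y - mu)) \<longlongrightarrow> 0) (at mu)" by simp
  qed
  then show ?thesis using LIM_zero_iff by blast
qed

text \<open>The initial data do not depend on lam, so the difference quotient at mu has zero initial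
  data and inhomogeneity \<open>Y lam\<close>. Two quotients then differ by a solution with
  inhomogeneity \<open>Y x - Y y\<close>, which is small because Y is Lipschitz at mu.\<close>

lemma hill_sol_field_differentiable:
  assumes q: "integrable (lebesgue_on {0..1}) q"
    and Y: "\<And>lam. hill_sol q lam (Y lam) (Y' lam)" "\<And>lam. Y lam 0 = a" "\<And>lam. Y' lam 0 = b"
    and t: "t \<in> {0..1}"
  shows "(\<lambda>lam. Y lam t) field_differentiable (at mu)" "(\<lambda>lam. Y' lam t) field_differentiable (at mu)"
proof -
  obtain C where C: "C > 0"
    "\<And>h g g' e t. \<lbrakk>hill_sol_inhom q mu h g g'; \<And>t. t \<in> {0..1} \<Longrightarrow> cmod (h t) \<le> e; t \<in> {0..1}\<rbrakk>
      \<Longrightarrow> cmod (g t) + cmod (g' t) \<le> C * (cmod (g 0) + cmod (g' 0) + e)"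
    using hill_sol_inhom_bound[OF q, of mu] by metis
  \<comment> \<open>\<open>r\<close> is chosen so that C * r * max |Y| is half of max |Y| and can be
    absorbed; this doubles C (|a| + |b|) into \<open>A\<close>.\<close>
  define A where "A = 2 * (C * (cmod a + cmod b))"
  define r where "r = 1 / (2 * C)"
  have r: "r > 0" using C by (simp add: r_def)
  have Y_bound: "cmod (Y lam s) \<le> A" if lam: "cmod (lam - mu) < r" and s: "s \<in> {0..1}" for lam s
  proof -
    have "continuous_on {0..1} (\<lambda>x. cmod (Y lam x))"
      by (intro continuous_intros hill_sol_continuous[OF Y(1)])
    then obtain x where x: "x \<in> {0..1}" "\<And>y. y \<in> {0..1} \<Longrightarrow> cmod (Y lam y) \<le> cmod (Y lam x)"
      using continuous_attains_sup[of "{0..1::real}" "\<lambda>x. cmod (Y lam x)"] by auto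
    have "cmod (Y lam x) + cmod (Y' lam x)
        \<le> C * (cmod (Y lam 0) + cmod (Y' lam 0) + r * cmod (Y lam x))"
    proof (rule C(2)[OF hill_sol_inhom_shift[OF Y(1)] _ x(1)])
      fix y :: real assume "y \<in> {0..1}"
      then show "cmod ((lam - mu) * Y lam y) \<le> r * cmod (Y lam x)"
        unfolding norm_mult using lam r x(2) by (intro mult_mono) auto
    qed
    also have "\<dots> = A / 2 + cmod (Y lam x) / 2"
      using C(1) by (simp add: A_def Y r_def field_simps)
    finally have "cmod (Y lam x) \<le> A"
      using norm_ge_zero[of "Y' lam x"] by linarith
    then show ?thesis using x(2)[OF s] by simp
  qed
  have A0: "A \<ge> 0" using C(1) by (simp add: A_def)
  have diff: "hill_sol_inhom q mu (\<lambda>x. (lam - mu) * Y lam x) (\<lambda>x. Y lam x - Y mu x) (\<lambda>x. Y' lam x - Y' mu x)" for lam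
    using hill_sol_inhom_diff[OF hill_sol_inhom_shift[OF Y(1)], of mu "\<lambda>_. 0" "Y mu" "Y' mu" lam] Y(1)
    by (simp add: hill_sol_inhom_0)
  have lip: "cmod (Y lam s - Y mu s) \<le> C * A * cmod (lam - mu)"
    if lam: "cmod (lam - mu) < r" and s: "s \<in> {0..1}" for lam s
  proof -
    have "cmod (Y lam s - Y mu s) \<le> cmod (Y lam s - Y mu s) + cmod (Y' lam s - Y' mu s)"
      by simp
    also have "\<dots> \<le> C * (cmod (Y lam 0 - Y mu 0) + cmod (Y' lam 0 - Y' mu 0) + cmod (lam - mu) * A)"
      by (rule C(2)[OF diff _ s]) (use Y_bound[OF lam] in \<open>auto simp: norm_mult intro!: mult_left_mono\<close>)
    finally show ?thesis
      by (simp add: Y mult_ac)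
  qed
  let ?z = "\<lambda>lam x. (Y lam x - Y mu x) / (lam - mu)" and ?z' = "\<lambda>lam x. (Y' lam x - Y' mu x) / (lam - mu)"
  have quot: "hill_sol_inhom q mu (Y lam) (?z lam) (?z' lam)" if "lam \<noteq> mu" for lam
    using hill_sol_inhom_cmult[OF diff, of "1 / (lam - mu)" lam] that by simp
  have two: "cmod (?z x t - ?z y t) + cmod (?z' x t - ?z' y t) \<le> C * (C * A) * (cmod (x - mu) + cmod (y - mu))"
    if xy: "x \<noteq> mu" "y \<noteq> mu" "cmod (x - mu) < r" "cmod (y - mu) < r" for x y
  proof -
    have "cmod (?z x t - ?z y t) + cmod (?z' x t - ?z' y t)
       \<le> C * (cmod (?z x 0 - ?z y 0) + cmod (?z' x 0 - ?z' y 0) + C * A * (cmod (x - mu) + cmod (y - mu)))"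
    proof (rule C(2)[OF hill_sol_inhom_diff[OF quot quot] _ t])
      fix s :: real assume s: "s \<in> {0..1}"
      have "cmod (Y x s - Y y s) \<le> cmod (Y x s - Y mu s) + cmod (Y y s - Y mu s)"
        using norm_triangle_ineq4[of "Y x s - Y mu s" "Y y s - Y mu s"] by simp
      also have "\<dots> \<le> C * A * cmod (x - mu) + C * A * cmod (y - mu)"
        using xy s by (intro add_mono lip)
      finally show "cmod (Y x s - Y y s) \<le> C * A * (cmod (x - mu) + cmod (y - mu))"
        by (simp add: distrib_left)
    qed (use xy in auto)
    then show ?thesis by (simp add: Y mult_ac)
  qed
  have "\<exists>L. ((\<lambda>lam. ?z lam t) \<longlongrightarrow> L) (at mu)"
    by (rule tendsto_of_two_point_bound[OF r, where K = "C * (C * A)"])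
       (use two in \<open>smt (verit) norm_ge_zero\<close>)
  moreover have "\<exists>L. ((\<lambda>lam. ?z' lam t) \<longlongrightarrow> L) (at mu)"
    by (rule tendsto_of_two_point_bound[OF r, where K = "C * (C * A)"])
       (use two in \<open>smt (verit) norm_ge_zero\<close>)
  ultimately show "(\<lambda>lam. Y lam t) field_differentiable (at mu)" "(\<lambda>lam. Y' lam t) field_differentiable (at mu)"
    unfolding field_differentiable_def has_field_derivative_iff by blast+
qed

section \<open>The twisted Kirchhoff conditions\<close>

text \<open>Two-sided orbit of a point: G plays the inverse of F, and the lemmas below ask only for
  the one-sided cancellation that they use.\<close>

definition int_iter :: "('a \<Rightarrow> 'a) \<Rightarrow> ('a \<Rightarrow> 'a) \<Rightarrow> int \<Rightarrow> 'a \<Rightarrow> 'a" where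
  "int_iter F G n = (if n \<ge> 0 then F ^^ nat n else G ^^ nat (- n))"

lemma int_iter_0 [simp]: "int_iter F G 0 p = p"
  by (simp add: int_iter_def)

lemma int_iter_add1:
  assumes FG: "\<And>p. F (G p) = p"
  shows "int_iter F G (n + 1) p = F (int_iter F G n p)"
proof (cases "n \<ge> 0")
  case True
  then show ?thesis by (simp add: int_iter_def nat_add_distrib)
next
  case False
  define i where "i = nat (- n - 1)"
  have n: "nat (- n) = Suc i" "nat (- (n + 1)) = i" using False by (auto simp: i_def)
  show ?thesis
  proof (cases "n = -1")
    \<comment> \<open>The passage from backward to forward iteration: n + 1 = 0 already lies in the
      other branch of \<open>int_iter\<close>.\<close>
    case True
    then show ?thesis using FG by (simp add: int_iter_def)
  next
    case False
    then have "\<not> n + 1 \<ge> 0" "\<not> n \<ge> 0" using \<open>\<not> n \<ge> 0\<close> by auto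
    then show ?thesis using FG n by (simp add: int_iter_def del: minus_add_distrib)
  qed
qed

lemma int_recurrence_unique:
  fixes x y :: "int \<Rightarrow> 'a"
  assumes "\<And>n. x (n + 1) = F (x n)" "\<And>n. y (n + 1) = F (y n)" "x 0 = y 0" and GF: "\<And>p. G (F p) = p"
  shows "x n = y n"
proof (induction n rule: int_induct[where k = 0])
  case base
  then show ?case by (rule assms)
next
  case (step1 i)
  then show ?case using assms by simp
next
  case (step2 i)
  have "x (i - 1) = G (x i)" "y (i - 1) = G (y i)"
    using assms(1)[of "i - 1"] assms(2)[of "i - 1"] GF by (simp_all add: GF)
  then show ?case using step2 by simp
qed

section \<open>The twist and its half powers\<close>

lemma sN_power: "sN N ^ k = cis (2 * pi * real k / real N)"
  by (simp add: sN_def Complex.DeMoivre mult_ac)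

lemma one_plus_sN_power:
  "1 + sN N ^ k = 2 * complex_of_real (ck N k) * cis (pi * real k / real N)"
proof -
  let ?x = "pi * real k / real N"
  have s: "sN N ^ k = cis ?x * cis ?x"
    by (simp add: sN_power cis_mult mult_ac)
  have "2 * complex_of_real (ck N k) = cis ?x + cis (- ?x)"
    by (simp add: ck_def complex_eq_iff)
  then have "2 * complex_of_real (ck N k) * cis ?x = cis ?x * cis ?x + cis (- ?x) * cis ?x"
    by (simp only: distrib_right)
  then show ?thesis by (simp add: s cis_mult)
qed

text \<open>A zero of the cosine would give 2 k = i (2 m + 1) with i odd, an even number equal to an
  odd one. This is where N odd enters.\<close>

lemma ck_nonzero:
  assumes k: "k < 2 * m + 1"
  shows "ck (2 * m + 1) k \<noteq> 0"
proof
  assume "ck (2 * m + 1) k = 0"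
  then obtain i where i: "odd i" "pi * real k / real (2 * m + 1) = of_int i * (pi / 2)"
    unfolding ck_def cos_zero_iff_int by blast
  then have "2 * real k = of_int i * real (2 * m + 1)"
    by (simp add: field_simps del: of_nat_add of_nat_mult of_nat_Suc)
  then have "2 * int k = i * int (2 * m + 1)"
    by (metis (mono_tags, opaque_lifting) of_int_eq_iff of_int_mult of_int_numeral of_int_of_nat_eq)
  then show False using i(1) by (metis dvd_triv_left even_mult_iff even_of_nat even_plus_one_iff)
qed

section \<open>Solving the vertex conditions in one cell\<close>

text \<open>In the following \<open>A, B, A', B'\<close> are the entries of \<open>\<M>\<close>, so that \<open>2 \<Delta> = A + B'\<close>, and \<open>s\<close> is the
  twist \<open>s\<^sup>k\<close>; pairs are initial data \<open>(f 0, f' 0)\<close> on an edge.\<close>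
definition step_u :: "complex \<Rightarrow> complex \<Rightarrow> complex \<Rightarrow> complex \<Rightarrow> complex \<Rightarrow> complex \<times> complex \<Rightarrow> complex" where
  "step_u A B A' B' s p = ((A + B') * (A * fst p + B * snd p) + B * (A' * fst p + B' * snd p)) / (1 + s)"

text \<open>Here and in \<open>init2\<close> the slope is the one that produces a prescribed value
  at t = 1, namely \<open>step_u\<close> on edge (n, 1) and the end value of edge (n, 0) divided by
  s on edge (n, 2). Division by B solves this Dirichlet problem.\<close>

definition init1 :: "complex \<Rightarrow> complex \<Rightarrow> complex \<Rightarrow> complex \<Rightarrow> complex \<Rightarrow> complex \<times> complex \<Rightarrow> complex \<times> complex" where
  "init1 A B A' B' s p = (A * fst p + B * snd p,
     (step_u A B A' B' s p - A * (A * fst p + B * snd p)) / B)"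

definition init2 :: "complex \<Rightarrow> complex \<Rightarrow> complex \<Rightarrow> complex \<Rightarrow> complex \<Rightarrow> complex \<times> complex \<Rightarrow> complex \<times> complex" where
  "init2 A B A' B' s p = (step_u A B A' B' s p,
     ((A * fst p + B * snd p) / s - A * step_u A B A' B' s p) / B)"

text \<open>\<open>step_u\<close> is the value at the vertex joining (n, 1), (n, 2) and (n + 1, 0).
  The second component is the slope that the Kirchhoff condition there leaves for (n + 1, 0),
  simplified by the Wronskian identity.\<close>

definition step :: "complex \<Rightarrow> complex \<Rightarrow> complex \<Rightarrow> complex \<Rightarrow> complex \<Rightarrow> complex \<times> complex \<Rightarrow> complex \<times> complex" where
  "step A B A' B' s p = (step_u A B A' B' s p,
     ((A + B') * step_u A B A' B' s p - (1 + 1 / s) * (A * fst p + B * snd p)) / B)"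

text \<open>Let v, w be the end value and slope on edge (n, 0). Continuity expresses p' and r'
  through v and the vertex value u; by the Wronskian identity the first Kirchhoff condition
  collapses to (1 + s) u = (A + B') v + B w. The equivalence serves existence and uniqueness
  alike.\<close>

lemma kirchhoff_iff:
  assumes W: "A * B' - A' * B = 1" and nz: "B \<noteq> 0" "s \<noteq> 0" "1 + s \<noteq> 0"
  shows "(A * a + B * b = p \<and> p = s * (A * r + B * r') \<and>
      d = A * p + B * p' \<and> A * p + B * p' = r \<and>
      - (A' * a + B' * b) + p' - s * (A' * r + B' * r') = 0 \<and>
      d' - (A' * p + B' * p') + r' = 0)
    \<longleftrightarrow> (p, p') = init1 A B A' B' s (a, b) \<and> (r, r') = init2 A B A' B' s (a, b) \<and> (d, d') = step A B A' B' s (a, b)"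
    (is "?L \<longleftrightarrow> ?R")
proof -
  define v w where "v = A * a + B * b" and "w = A' * a + B' * b"
  define u where "u = step_u A B A' B' s (a, b)"
  have u: "(1 + s) * u = (A + B') * v + B * w"
    using nz by (simp add: u_def step_u_def v_def w_def)
  \<comment> \<open>Clearing the denominators B and s leaves polynomial relations.\<close>
  have R: "?R \<longleftrightarrow> p = v \<and> B * p' = u - A * v \<and> r = u \<and> s * B * r' = v - s * A * u
      \<and> d = u \<and> s * B * d' = s * (A + B') * u - (s + 1) * v"
    using nz by (auto simp: prod_eq_iff init1_def init2_def step_def u_def[symmetric] v_def[symmetric] field_simps)
  have L: "?L \<longleftrightarrow> v = p \<and> p = s * (A * r + B * r') \<and>
      d = A * p + B * p' \<and> A * p + B * p' = r \<and>
      - w + p' - s * (A' * r + B' * r') = 0 \<and>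
      d' - (A' * p + B' * p') + r' = 0"
    by (simp add: v_def w_def)
  show ?thesis
    unfolding L R
  proof (intro iffI; elim conjE)
    assume h: "v = p" "p = s * (A * r + B * r')" "d = A * p + B * p'"
      "A * p + B * p' = r" "- w + p' - s * (A' * r + B' * r') = 0"
      "d' - (A' * p + B' * p') + r' = 0"
    have "(1 + s) * r = (A + B') * v + B * w"
      using h W by algebra
    then have x2: "r = u"
      using u nz(3) by (metis mult_left_cancel)
    show "p = v \<and> B * p' = u - A * v \<and> r = u \<and> s * B * r' = v - s * A * u
      \<and> d = u \<and> s * B * d' = s * (A + B') * u - (s + 1) * v"
    proof (intro conjI)
      show "s * B * d' = s * (A + B') * u - (s + 1) * v"
        using h W x2 by algebra
      show "s * B * r' = v - s * A * u"
        unfolding x2[symmetric] h(1) h(2) by (simp add: algebra_simps)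
      show "B * p' = u - A * v"
        unfolding h(1) x2[symmetric] h(4)[symmetric] by simp
    qed (use h x2 in auto)
  next
    assume h: "p = v" "B * p' = u - A * v" "r = u" "s * B * r' = v - s * A * u"
      "d = u" "s * B * d' = s * (A + B') * u - (s + 1) * v"
    \<comment> \<open>The Kirchhoff sums follow polynomially only after multiplication by B or s *
      B; the nonzero factors are cancelled at the end.\<close>
    have "B * (- w + p' - s * (A' * r + B' * r')) = 0"
      unfolding h(3) using h(2,4) W u by algebra
    moreover have "s * B * (d' - (A' * p + B' * p') + r') = 0"
      unfolding h(1) using h(2,4,6) W by algebra
    moreover have "A * p + B * p' = r"
      unfolding h(1) h(2) h(3) by simp
    moreover have "p = s * (A * r + B * r')"
      unfolding h(1,3) using h(4) by (simp add: algebra_simps)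
    ultimately show "v = p \<and> p = s * (A * r + B * r') \<and>
      d = A * p + B * p' \<and> A * p + B * p' = r \<and>
      - w + p' - s * (A' * r + B' * r') = 0 \<and>
      d' - (A' * p + B' * p') + r' = 0"
      using h(1,3,5) nz(1,2) mult_eq_0_iff by metis
  qed
qed

definition m11 :: "complex \<Rightarrow> complex \<Rightarrow> complex \<Rightarrow> complex \<Rightarrow> complex \<Rightarrow> complex" where
  "m11 A B A' B' s = ((A + B') * A + B * A') / (1 + s)"
definition m12 :: "complex \<Rightarrow> complex \<Rightarrow> complex \<Rightarrow> complex \<Rightarrow> complex \<Rightarrow> complex" where
  "m12 A B A' B' s = ((A + B') * B + B * B') / (1 + s)"
definition m21 :: "complex \<Rightarrow> complex \<Rightarrow> complex \<Rightarrow> complex \<Rightarrow> complex \<Rightarrow> complex" where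
  "m21 A B A' B' s = ((A + B') * m11 A B A' B' s - (1 + 1 / s) * A) / B"
definition m22 :: "complex \<Rightarrow> complex \<Rightarrow> complex \<Rightarrow> complex \<Rightarrow> complex \<Rightarrow> complex" where
  "m22 A B A' B' s = ((A + B') * m12 A B A' B' s - (1 + 1 / s) * B) / B"

lemma step_linear:
  "step A B A' B' s p = (m11 A B A' B' s * fst p + m12 A B A' B' s * snd p,
     m21 A B A' B' s * fst p + m22 A B A' B' s * snd p)"
proof -
  have "step_u A B A' B' s p = m11 A B A' B' s * fst p + m12 A B A' B' s * snd p"
    by (simp add: step_u_def m11_def m12_def add_divide_distrib distrib_left distrib_right mult_ac)
  then show ?thesis
    by (simp add: step_def m21_def m22_def add_divide_distrib diff_divide_distrib algebra_simps)
qed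

text \<open>The second row is a multiple of the first minus (1 + 1/s) (A, B) / B. The multiple drops
  out of the determinant, and the rest is evaluated by the Wronskian identity.\<close>

lemma monodromy_det:
  assumes W: "A * B' - A' * B = 1" and nz: "B \<noteq> 0" "s \<noteq> 0" "1 + s \<noteq> 0"
  shows "m11 A B A' B' s * m22 A B A' B' s - m12 A B A' B' s * m21 A B A' B' s = 1 / s"
proof -
  have "A * m12 A B A' B' s - B * m11 A B A' B' s = B / (1 + s)"
    using W by (simp add: m11_def m12_def flip: diff_divide_distrib) algebra
  moreover have "m11 A B A' B' s * m22 A B A' B' s - m12 A B A' B' s * m21 A B A' B' s
      = (1 + 1 / s) * (A * m12 A B A' B' s - B * m11 A B A' B' s) / B"
    by (simp add: m21_def m22_def algebra_simps flip: diff_divide_distrib)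
  ultimately show ?thesis
    using nz by (simp add: field_simps)
qed

lemma monodromy_trace:
  assumes nz: "B \<noteq> 0"
  shows "m11 A B A' B' s + m22 A B A' B' s = (2 * (A + B')\<^sup>2 + B * A') / (1 + s) - (1 + 1 / s)"
proof -
  have m22: "m22 A B A' B' s = (A + B') * ((A + B') + B') / (1 + s) - (1 + 1 / s)"
  proof -
    define r where "r = ((A + B') + B') / (1 + s)"
    have "m12 A B A' B' s = B * r"
      by (simp add: m12_def r_def algebra_simps)
    then have "m22 A B A' B' s = (A + B') * r - (1 + 1 / s)"
      using nz by (simp add: m22_def field_simps)
    then show ?thesis by (simp add: r_def)
  qed
  show ?thesis
    unfolding m22 m11_def divide_inverse power2_eq_square by (simp add: algebra_simps)
qed

text \<open>Cramer's rule: the adjugate of the matrix of \<open>step\<close>, times s because the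
  determinant is 1/s.\<close>

definition step_inv :: "complex \<Rightarrow> complex \<Rightarrow> complex \<Rightarrow> complex \<Rightarrow> complex \<Rightarrow> complex \<times> complex \<Rightarrow> complex \<times> complex" where
  "step_inv A B A' B' s p = (s * (m22 A B A' B' s * fst p - m12 A B A' B' s * snd p),
     s * (m11 A B A' B' s * snd p - m21 A B A' B' s * fst p))"

lemma step_step_inv:
  assumes "A * B' - A' * B = 1" "B \<noteq> 0" "s \<noteq> 0" "1 + s \<noteq> 0"
  shows "step A B A' B' s (step_inv A B A' B' s p) = p"
    and "step_inv A B A' B' s (step A B A' B' s p) = p"
proof -
  have "s * (m11 A B A' B' s * m22 A B A' B' s - m12 A B A' B' s * m21 A B A' B' s) = 1"
    using monodromy_det[OF assms] assms by simp
  then show "step A B A' B' s (step_inv A B A' B' s p) = p"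
    and "step_inv A B A' B' s (step A B A' B' s p) = p"
    unfolding step_linear step_inv_def prod_eq_iff fst_conv snd_conv by algebra+
qed

section \<open>Calculus of 2x2 matrices\<close>

lemma mat2_nth [simp]:
  "mat2 a b c d $ 1 $ 1 = a" "mat2 a b c d $ 1 $ 2 = b"
  "mat2 a b c d $ 2 $ 1 = c" "mat2 a b c d $ 2 $ 2 = d"
  by (simp_all add: mat2_def)

lemma mat2_mult: "mat2 a b c d ** mat2 a' b' c' d'
    = mat2 (a * a' + b * c') (a * b' + b * d') (c * a' + d * c') (c * b' + d * d')"
  by (simp add: vec_eq_iff forall_2 matrix_matrix_mult_def sum_2)

lemma matrix_inv_mat2_diag:
  assumes "B \<noteq> 0"
  shows "matrix_inv (mat2 1 0 0 B) = mat2 1 0 0 (1 / B)"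
proof -
  \<comment> \<open>\<open>matrix_inv\<close> is a choice term, so it has to be identified with a
    given two-sided inverse.\<close>
  have inv: "matrix_inv X = Y" if XY: "X ** Y = mat 1" "Y ** X = mat 1" for X Y :: "complex^2^2"
  proof -
    have "matrix_inv X ** X = mat 1"
      unfolding matrix_inv_def by (rule someI2[of _ Y]) (use XY in auto)
    then show ?thesis
      using XY(1) by (metis matrix_mul_assoc matrix_mul_lid matrix_mul_rid)
  qed
  have "mat 1 = mat2 1 0 0 1"
    by (simp add: vec_eq_iff forall_2 mat_def)
  then show ?thesis
    using assms by (intro inv) (simp_all add: mat2_mult)
qed

lemma det_mat2: "det (mat2 a b c d) = a * d - b * c"
  by (simp add: det_2)

lemma trace_mat2: "trace (mat2 a b c d) = a + d"
  by (simp add: trace_def sum_2)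

lemma det_mat2_minus_mat:
  "det (mat2 a b c d - mat \<tau>) = \<tau>\<^sup>2 - \<tau> * (a + d) + (a * d - b * c)"
  by (simp add: det_2 mat_def power2_eq_square algebra_simps)

lemma sN_power_nonzero: "sN N ^ k \<noteq> 0"
  by (simp add: sN_def)

lemma one_plus_sN_nonzero: "k < 2 * m + 1 \<Longrightarrow> 1 + sN (2 * m + 1) ^ k \<noteq> 0"
  unfolding one_plus_sN_power using ck_nonzero by simp

text \<open>The prefactor s^(-k/2) / (2 c_k) equals 1 / (1 + s^k), and 4 c_k^2 / (1 + s^k) equals 1
  + 1 / s^k. The half powers disappear and T_k becomes rational in the twist.\<close>

lemma Tk_eq:
  assumes k: "k < 2 * m + 1"
  defines "s \<equiv> sN (2 * m + 1) ^ k"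
  shows "Tk (2 * m + 1) k D
    = mat2 (2 * D / (1 + s)) (1 / (1 + s)) (4 * D\<^sup>2 / (1 + s) - (1 + 1 / s)) (2 * D / (1 + s))"
proof -
  let ?N = "2 * m + 1"
  define c where "c = complex_of_real (ck ?N k)"
  define e where "e = cis (pi * real k / real ?N)"
  have c: "c \<noteq> 0" using ck_nonzero[OF k] by (simp add: c_def)
  have e: "e \<noteq> 0" by (simp add: e_def)
  have s: "s = e * e" by (simp add: s_def e_def sN_power cis_mult mult_ac)
  have s1: "1 + s = 2 * c * e"
    unfolding s_def c_def e_def by (rule one_plus_sN_power)
  have "cis (- pi * real k / real ?N) = 1 / e"
    by (simp add: e_def divide_inverse cis_inverse)
  then have f: "cis (- pi * real k / real ?N) / (2 * c) = 1 / (1 + s)"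
    by (simp add: s1 mult_ac)
  have "(1 + 1 / s) = (1 + s) / s" using e by (simp add: s field_simps)
  also have "\<dots> = (4 * c\<^sup>2) / (1 + s)"
    using c e by (simp add: s1) (simp add: s field_simps power2_eq_square)
  finally have \<kappa>: "(4 * c\<^sup>2) / (1 + s) = 1 + 1 / s" by simp
  show ?thesis
    unfolding Tk_def Let_def c_def[symmetric] f
    by (simp add: right_diff_distrib \<kappa>[symmetric] diff_divide_distrib)
qed

section \<open>The families on the edges of Gamma^1\<close>

locale hill_fundamental =
  fixes q :: "real \<Rightarrow> real" and th th' ph ph' :: "complex \<Rightarrow> real \<Rightarrow> complex"
  assumes q: "integrable (lebesgue_on {0..1}) q"
    and th: "\<And>lam. hill_sol q lam (th lam) (th' lam)" "\<And>lam. th lam 0 = 1" "\<And>lam. th' lam 0 = 0"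
    and ph: "\<And>lam. hill_sol q lam (ph lam) (ph' lam)" "\<And>lam. ph lam 0 = 0" "\<And>lam. ph' lam 0 = 1"
begin

lemma wronskian: "th lam 1 * ph' lam 1 - th' lam 1 * ph lam 1 = 1"
  using hill_sol_wronskian[OF q ph(1) th(1), of lam] by (simp add: th ph)

lemma hill_sol_expand:
  assumes g: "hill_sol q lam g g'" and t: "t \<in> {0..1}"
  shows "g t = th lam t * g 0 + ph lam t * g' 0" "g' t = th' lam t * g 0 + ph' lam t * g' 0"
  using hill_sol_unique[OF q g hill_sol_lincomb[OF th(1) ph(1), of lam "g 0" "g' 0"] _ _ t]
  by (simp_all add: th ph mult.commute)

lemma holomorphic_fundamental:
  assumes t: "t \<in> {0..1}"
  shows "(\<lambda>lam. th lam t) holomorphic_on UNIV" "(\<lambda>lam. th' lam t) holomorphic_on UNIV"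
    and "(\<lambda>lam. ph lam t) holomorphic_on UNIV" "(\<lambda>lam. ph' lam t) holomorphic_on UNIV"
  using hill_sol_field_differentiable[OF q th t] hill_sol_field_differentiable[OF q ph t]
  by (auto simp: holomorphic_on_def)

lemma meromorphic_fundamental:
  assumes t: "t \<in> {0..1}"
  shows "(\<lambda>lam. th lam t) meromorphic_on UNIV" "(\<lambda>lam. th' lam t) meromorphic_on UNIV"
    and "(\<lambda>lam. ph lam t) meromorphic_on UNIV" "(\<lambda>lam. ph' lam t) meromorphic_on UNIV"
  by (intro analytic_on_imp_meromorphic_on analytic_on_holomorphic[THEN iffD2] exI[of _ UNIV]
      conjI open_UNIV subset_UNIV holomorphic_fundamental[OF t])+

abbreviation "hstep lam s \<equiv> step (th lam 1) (ph lam 1) (th' lam 1) (ph' lam 1) s"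
abbreviation "hstep_inv lam s \<equiv> step_inv (th lam 1) (ph lam 1) (th' lam 1) (ph' lam 1) s"
abbreviation "hinit1 lam s \<equiv> init1 (th lam 1) (ph lam 1) (th' lam 1) (ph' lam 1) s"
abbreviation "hinit2 lam s \<equiv> init2 (th lam 1) (ph lam 1) (th' lam 1) (ph' lam 1) s"

text \<open>Initial data at t = 0 on every edge, propagated from p on edge (0, 0); within
  \<open>Edges1\<close> the last branch means j = 2.\<close>

definition edge_init :: "complex \<Rightarrow> complex \<Rightarrow> complex \<times> complex \<Rightarrow> int \<times> nat \<Rightarrow> complex \<times> complex" where
  "edge_init s lam p = (\<lambda>(n, j). let x = int_iter (hstep lam s) (hstep_inv lam s) n p in
     if j = 0 then x else if j = 1 then hinit1 lam s x else hinit2 lam s x)"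

definition fam :: "complex \<Rightarrow> complex \<times> complex \<Rightarrow> complex \<Rightarrow> int \<times> nat \<Rightarrow> real \<Rightarrow> complex" where
  "fam s p lam a t = fst (edge_init s lam p a) * th lam t + snd (edge_init s lam p a) * ph lam t"

definition fam' :: "complex \<Rightarrow> complex \<times> complex \<Rightarrow> complex \<Rightarrow> int \<times> nat \<Rightarrow> real \<Rightarrow> complex" where
  "fam' s p lam a t = fst (edge_init s lam p a) * th' lam t + snd (edge_init s lam p a) * ph' lam t"

lemma hill_sol_fam: "hill_sol q lam (fam s p lam a) (fam' s p lam a)"
  using hill_sol_lincomb[OF th(1) ph(1)] by (simp add: fam_def[abs_def] fam'_def[abs_def])

lemma fam_at_0: "fam s p lam a 0 = fst (edge_init s lam p a)" "fam' s p lam a 0 = snd (edge_init s lam p a)"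
  by (simp_all add: fam_def fam'_def th ph)

text \<open>Values at t = 1 are the matrix M applied to the initial data, so the twisted conditions
  become one algebraic system per cell.\<close>

lemma fam_sol_iff:
  assumes lam: "ph lam 1 \<noteq> 0" and k: "1 + sN N ^ k \<noteq> 0"
    and f: "\<And>a. a \<in> Edges1 \<Longrightarrow> hill_sol q lam (f a) (f' a)"
  shows "fam_sol q N k lam f f' \<longleftrightarrow> (\<forall>n.
      (f (n, 1) 0, f' (n, 1) 0) = hinit1 lam (sN N ^ k) (f (n, 0) 0, f' (n, 0) 0) \<and>
      (f (n, 2) 0, f' (n, 2) 0) = hinit2 lam (sN N ^ k) (f (n, 0) 0, f' (n, 0) 0) \<and>
      (f (n + 1, 0) 0, f' (n + 1, 0) 0) = hstep lam (sN N ^ k) (f (n, 0) 0, f' (n, 0) 0))"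
proof -
  have e: "f (n, j) 1 = th lam 1 * f (n, j) 0 + ph lam 1 * f' (n, j) 0"
    "f' (n, j) 1 = th' lam 1 * f (n, j) 0 + ph' lam 1 * f' (n, j) 0" if "j < 3" for n j
    using hill_sol_expand[OF f, of "(n, j)" 1] that by (auto simp: Edges1_def)
  have e012: "f (n, 0) 1 = th lam 1 * f (n, 0) 0 + ph lam 1 * f' (n, 0) 0"
    "f' (n, 0) 1 = th' lam 1 * f (n, 0) 0 + ph' lam 1 * f' (n, 0) 0"
    "f (n, 1) 1 = th lam 1 * f (n, 1) 0 + ph lam 1 * f' (n, 1) 0"
    "f' (n, 1) 1 = th' lam 1 * f (n, 1) 0 + ph' lam 1 * f' (n, 1) 0"
    "f (n, 2) 1 = th lam 1 * f (n, 2) 0 + ph lam 1 * f' (n, 2) 0"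
    "f' (n, 2) 1 = th' lam 1 * f (n, 2) 0 + ph' lam 1 * f' (n, 2) 0" for n
    by (rule e; simp)+
  have "K0K1 N k f f' \<longleftrightarrow> (\<forall>n.
      (f (n, 1) 0, f' (n, 1) 0) = hinit1 lam (sN N ^ k) (f (n, 0) 0, f' (n, 0) 0) \<and>
      (f (n, 2) 0, f' (n, 2) 0) = hinit2 lam (sN N ^ k) (f (n, 0) 0, f' (n, 0) 0) \<and>
      (f (n + 1, 0) 0, f' (n + 1, 0) 0) = hstep lam (sN N ^ k) (f (n, 0) 0, f' (n, 0) 0))"
    unfolding K0K1_def
  proof (rule all_cong1)
    fix n
    show "(f (n, 0) 1 = f (n, 1) 0 \<and> f (n, 1) 0 = sN N ^ k * f (n, 2) 1 \<and>
       f (n + 1, 0) 0 = f (n, 1) 1 \<and> f (n, 1) 1 = f (n, 2) 0 \<and>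
       - f' (n, 0) 1 + f' (n, 1) 0 - sN N ^ k * f' (n, 2) 1 = 0 \<and>
       f' (n + 1, 0) 0 - f' (n, 1) 1 + f' (n, 2) 0 = 0) \<longleftrightarrow>
      (f (n, 1) 0, f' (n, 1) 0) = hinit1 lam (sN N ^ k) (f (n, 0) 0, f' (n, 0) 0) \<and>
      (f (n, 2) 0, f' (n, 2) 0) = hinit2 lam (sN N ^ k) (f (n, 0) 0, f' (n, 0) 0) \<and>
      (f (n + 1, 0) 0, f' (n + 1, 0) 0) = hstep lam (sN N ^ k) (f (n, 0) 0, f' (n, 0) 0)"
      using kirchhoff_iff[OF wronskian lam sN_power_nonzero k]
      by (simp only: e012)
  qed
  then show ?thesis using f by (simp add: fam_sol_def)
qed

lemma int_iter_hstep:
  assumes "ph lam 1 \<noteq> 0" "1 + sN N ^ k \<noteq> 0"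
  shows "int_iter (hstep lam (sN N ^ k)) (hstep_inv lam (sN N ^ k)) (n + 1) p
    = hstep lam (sN N ^ k) (int_iter (hstep lam (sN N ^ k)) (hstep_inv lam (sN N ^ k)) n p)"
  by (rule int_iter_add1) (rule step_step_inv(1)[OF wronskian assms(1) sN_power_nonzero assms(2)])

lemma fam_sol_fam:
  assumes "ph lam 1 \<noteq> 0" "1 + sN N ^ k \<noteq> 0"
  shows "fam_sol q N k lam (fam (sN N ^ k) p lam) (fam' (sN N ^ k) p lam)"
  using assms by (simp add: fam_sol_iff hill_sol_fam fam_at_0 edge_init_def int_iter_hstep)

text \<open>The data on the edges (n, 0) obey a first order recurrence whose invertibility fixes
  them for negative n too. Uniqueness for the Hill equation then fixes the function on each
  edge.\<close>

lemma fam_sol_unique: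
  assumes lam: "ph lam 1 \<noteq> 0" and k: "1 + sN N ^ k \<noteq> 0"
    and g: "fam_sol q N k lam g g'" and p: "g (0, 0) 0 = fst p" "g' (0, 0) 0 = snd p"
    and a: "a \<in> Edges1" and t: "t \<in> {0..1}"
  shows "g a t = fam (sN N ^ k) p lam a t"
proof -
  have sol: "\<And>a. a \<in> Edges1 \<Longrightarrow> hill_sol q lam (g a) (g' a)"
    using g by (simp add: fam_sol_def)
  note rec = fam_sol_iff[OF lam k sol, THEN iffD1, OF _ g, rule_format]
  let ?x = "\<lambda>n. int_iter (hstep lam (sN N ^ k)) (hstep_inv lam (sN N ^ k)) n p"
  have x: "(g (n, 0) 0, g' (n, 0) 0) = ?x n" for n
  proof (rule int_recurrence_unique[where F = "hstep lam (sN N ^ k)" and G = "hstep_inv lam (sN N ^ k)"])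
    show "(g (0, 0) 0, g' (0, 0) 0) = ?x 0" using p by simp
  qed (use rec int_iter_hstep[OF lam k] step_step_inv(2)[OF wronskian lam sN_power_nonzero k] in auto)
  obtain n j where nj: "a = (n, j)" "j < 3" using a by (auto simp: Edges1_def)
  have "(g a 0, g' a 0) = edge_init (sN N ^ k) lam p a"
    using rec[of n] x[of n] nj by (auto simp: edge_init_def numeral_3_eq_3 less_Suc_eq numeral_2_eq_2)
  then have "g a 0 = fam (sN N ^ k) p lam a 0" "g' a 0 = fam' (sN N ^ k) p lam a 0"
    by (simp_all add: fam_at_0 prod_eq_iff)
  then show ?thesis
    by (rule hill_sol_unique[OF q sol[OF a] hill_sol_fam _ _ t])
qed

lemma meromorphic_int_iter:
  "(\<lambda>lam. fst (int_iter (hstep lam s) (hstep_inv lam s) n p)) meromorphic_on UNIV \<and>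
   (\<lambda>lam. snd (int_iter (hstep lam s) (hstep_inv lam s) n p)) meromorphic_on UNIV"
proof -
  note m = meromorphic_fundamental[of 1, simplified]
  have "(\<lambda>lam. fst ((hstep lam s ^^ i) p)) meromorphic_on UNIV \<and>
      (\<lambda>lam. snd ((hstep lam s ^^ i) p)) meromorphic_on UNIV" for i
    by (induction i) (auto simp: step_def step_u_def intro!: meromorphic_intros m)
  moreover have "(\<lambda>lam. fst ((hstep_inv lam s ^^ i) p)) meromorphic_on UNIV \<and>
      (\<lambda>lam. snd ((hstep_inv lam s ^^ i) p)) meromorphic_on UNIV" for i
    by (induction i) (auto simp: step_inv_def m11_def m12_def m21_def m22_def intro!: meromorphic_intros m)
  ultimately show ?thesis by (cases "n \<ge> 0") (simp_all add: int_iter_def)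
qed

text \<open>Finitely many field operations on entire functions. On sigma_D the division by zero
  returns a default value, but meromorphy depends only on punctured neighbourhoods, so all of C is
  covered.\<close>

lemma meromorphic_fam:
  assumes t: "t \<in> {0..1}"
  shows "(\<lambda>lam. fam s p lam a t) meromorphic_on UNIV"
proof -
  obtain n j where a: "a = (n, j)" by force
  note m = meromorphic_fundamental[of 1, simplified]
  have "(\<lambda>lam. fst (edge_init s lam p a)) meromorphic_on UNIV \<and> (\<lambda>lam. snd (edge_init s lam p a)) meromorphic_on UNIV"
    using meromorphic_int_iter[of s n p]
    by (cases "j = 0"; cases "j = 1"; auto simp: a edge_init_def Let_def init1_def init2_def step_u_def intro!: meromorphic_intros m)
  then show ?thesis
    unfolding fam_def by (intro meromorphic_intros meromorphic_fundamental[OF t]) auto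
qed

lemma edge_init_1_0: "edge_init s lam p (1, 0) = hstep lam s p"
  by (simp add: edge_init_def int_iter_def)

end

section \<open>The monodromy matrix\<close>

text \<open>With trace T and constant determinant c this is the characteristic polynomial of a 2x2
  matrix, so joint holomorphy reduces to that of the trace in lam.\<close>

lemma entire2_char_poly:
  assumes T: "T holomorphic_on UNIV"
  shows "entire2 (\<lambda>p. (snd p)\<^sup>2 - snd p * T (fst p) + c)"
  unfolding entire2_def
proof
  fix p :: "complex \<times> complex"
  obtain T' where T': "(T has_field_derivative T') (at (fst p))"
    using T by (auto simp: holomorphic_on_def field_differentiable_def)
  have [derivative_intros]: "((\<lambda>p. T (fst p)) has_derivative (\<lambda>h. T' * fst h)) (at p)"
    using has_derivative_compose[OF has_derivative_fst[OF has_derivative_ident]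
        T'[unfolded has_field_derivative_def]] by simp
  have "((\<lambda>p. (snd p)\<^sup>2 - snd p * T (fst p) + c) has_derivative
      (\<lambda>h. (- snd p * T') * fst h + (2 * snd p - T (fst p)) * snd h)) (at p)"
    by (auto intro!: derivative_eq_intros simp: fun_eq_iff algebra_simps)
  then show "\<exists>A B. ((\<lambda>p. (snd p)\<^sup>2 - snd p * T (fst p) + c) has_derivative
      (\<lambda>h. A * fst h + B * snd h)) (at p)"
    by blast
qed

context hill_fundamental
begin

definition Dl :: "complex \<Rightarrow> complex" where
  "Dl lam = (ph' lam 1 + th lam 1) / 2"

definition Mmat :: "complex \<Rightarrow> complex^2^2" where
  "Mmat lam = mat2 (th lam 1) (ph lam 1) (th' lam 1) (ph' lam 1)"

definition Rmat :: "complex \<Rightarrow> complex^2^2" where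
  "Rmat lam = mat2 1 0 0 (ph lam 1)"

definition Dl0 :: "complex \<Rightarrow> complex" where
  "Dl0 lam = 2 * (Dl lam)\<^sup>2 + th' lam 1 * ph lam 1 / 4 - 1"

definition Mk :: "nat \<Rightarrow> nat \<Rightarrow> complex \<Rightarrow> complex^2^2" where
  "Mk N k lam = (let s = sN N ^ k in
     mat2 (fam s (1, 0) lam (1, 0) 0) (fam s (0, 1) lam (1, 0) 0)
          (fam' s (1, 0) lam (1, 0) 0) (fam' s (0, 1) lam (1, 0) 0))"

text \<open>The entire continuation of R M_k R^(-1): the second factor is R M R^(-1) with its
  division by \<phi>(1) carried out.\<close>

definition Emat :: "nat \<Rightarrow> nat \<Rightarrow> complex \<Rightarrow> complex^2^2" where
  "Emat N k lam = Tk N k (Dl lam) ** mat2 (th lam 1) 1 (ph lam 1 * th' lam 1) (ph' lam 1)"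

lemma RMR: "ph lam 1 \<noteq> 0 \<Longrightarrow> Rmat lam ** Mmat lam ** matrix_inv (Rmat lam)
    = mat2 (th lam 1) 1 (ph lam 1 * th' lam 1) (ph' lam 1)"
  by (simp add: Rmat_def Mmat_def matrix_inv_mat2_diag mat2_mult)

lemma Mk_entries:
  "Mk N k lam = (let s = sN N ^ k; A = th lam 1; B = ph lam 1; A' = th' lam 1; B' = ph' lam 1 in
     mat2 (m11 A B A' B' s) (m12 A B A' B' s) (m21 A B A' B' s) (m22 A B A' B' s))"
  by (simp add: Mk_def fam_at_0 edge_init_1_0 step_linear Let_def)

lemma Mk_eq:
  assumes k: "k < 2 * m + 1" and lam: "ph lam 1 \<noteq> 0"
  shows "Mk (2 * m + 1) k lam = matrix_inv (Rmat lam) ** Tk (2 * m + 1) k (Dl lam) ** Rmat lam ** Mmat lam"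
proof -
  have D: "2 * Dl lam = th lam 1 + ph' lam 1" by (simp add: Dl_def)
  have "4 * (Dl lam)\<^sup>2 = (2 * Dl lam) * (2 * Dl lam)" by (simp add: power2_eq_square)
  then have D2: "4 * (Dl lam)\<^sup>2 = (th lam 1 + ph' lam 1) * (th lam 1 + ph' lam 1)"
    by (simp only: D)
  show ?thesis
    unfolding Tk_eq[OF k] D D2 Rmat_def Mmat_def matrix_inv_mat2_diag[OF lam] mat2_mult Mk_entries Let_def
      m11_def m12_def m21_def m22_def divide_inverse
    using lam by (simp add: algebra_simps)
qed

lemma Mk_det:
  assumes k: "k < 2 * m + 1" and lam: "ph lam 1 \<noteq> 0"
  shows "det (Mk (2 * m + 1) k lam) = cis (- 2 * pi * real k / real (2 * m + 1))"
proof -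
  have "det (Mk (2 * m + 1) k lam) = 1 / sN (2 * m + 1) ^ k"
    using monodromy_det[OF wronskian lam sN_power_nonzero one_plus_sN_nonzero[OF k]]
    by (simp add: Mk_entries Let_def det_mat2)
  then show ?thesis
    by (simp add: sN_power divide_inverse cis_inverse)
qed

text \<open>Names the closed formula and not the trace itself, because it has to be entire across
  sigma_D.\<close>

definition Mk_trace :: "nat \<Rightarrow> nat \<Rightarrow> complex \<Rightarrow> complex" where
  "Mk_trace N k lam = 2 * (Dl0 lam + complex_of_real ((sk N k)\<^sup>2))
     / (cis (pi * real k / real N) * complex_of_real (ck N k))"

lemma Mk_trace:
  assumes k: "k < 2 * m + 1" and lam: "ph lam 1 \<noteq> 0"
  shows "trace (Mk (2 * m + 1) k lam) = Mk_trace (2 * m + 1) k lam"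
proof -
  let ?N = "2 * m + 1"
  define s where "s = sN ?N ^ k"
  define c where "c = complex_of_real (ck ?N k)"
  define e where "e = cis (pi * real k / real ?N)"
  have c: "c \<noteq> 0" using ck_nonzero[OF k] by (simp add: c_def)
  have e: "e \<noteq> 0" by (simp add: e_def)
  have s: "s = e * e" by (simp add: s_def e_def sN_power cis_mult mult_ac)
  have s1: "1 + s = 2 * c * e"
    unfolding s_def c_def e_def by (rule one_plus_sN_power)
  have \<kappa>: "1 + 1 / s = 2 * c / e"
  proof -
    have "1 + 1 / s = (1 + s) / s" using e by (simp add: s field_simps)
    then show ?thesis using e by (simp add: s1) (simp add: s)
  qed
  \<comment> \<open>1 - c_k^2 cancels the -1 in \<open>Dl0\<close>; the remaining -c_k^2 matches the
    term 1 + 1/s.\<close>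
  have sk: "complex_of_real ((sk ?N k)\<^sup>2) = 1 - c\<^sup>2"
    by (simp add: c_def sk_def ck_def sin_squared_eq)
  have "trace (Mk ?N k lam) = (2 * (th lam 1 + ph' lam 1)\<^sup>2 + ph lam 1 * th' lam 1) / (1 + s) - (1 + 1 / s)"
    using monodromy_trace[OF lam, where A = "th lam 1" and A' = "th' lam 1" and B' = "ph' lam 1" and s = s]
    by (simp add: Mk_entries Let_def trace_mat2 s_def)
  also have "(th lam 1 + ph' lam 1)\<^sup>2 = 4 * (Dl lam)\<^sup>2"
    by (simp add: Dl_def power_divide add.commute)
  also have "(2 * (4 * (Dl lam)\<^sup>2) + ph lam 1 * th' lam 1) / (1 + s) - (1 + 1 / s)
      = 2 * (Dl0 lam + (1 - c\<^sup>2)) / (e * c)"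
    unfolding s1 \<kappa> Dl0_def using c e by (simp add: field_simps power2_eq_square)
  finally show ?thesis
    unfolding Mk_trace_def sk by (simp only: c_def e_def)
qed

lemma Mk_conj:
  assumes k: "k < 2 * m + 1" and lam: "ph lam 1 \<noteq> 0"
  shows "Rmat lam ** Mk (2 * m + 1) k lam ** matrix_inv (Rmat lam)
      = Tk (2 * m + 1) k (Dl lam) ** Rmat lam ** Mmat lam ** matrix_inv (Rmat lam)"
    and "Emat (2 * m + 1) k lam = Rmat lam ** Mk (2 * m + 1) k lam ** matrix_inv (Rmat lam)"
proof -
  have "Rmat lam ** matrix_inv (Rmat lam) = mat 1"
    using lam by (simp add: Rmat_def matrix_inv_mat2_diag mat2_mult vec_eq_iff forall_2 mat_def)
  then show 1: "Rmat lam ** Mk (2 * m + 1) k lam ** matrix_inv (Rmat lam)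
      = Tk (2 * m + 1) k (Dl lam) ** Rmat lam ** Mmat lam ** matrix_inv (Rmat lam)"
    unfolding Mk_eq[OF assms] by (simp only: matrix_mul_assoc matrix_mul_lid)
  show "Emat (2 * m + 1) k lam = Rmat lam ** Mk (2 * m + 1) k lam ** matrix_inv (Rmat lam)"
    unfolding 1 Emat_def RMR[OF lam, symmetric] by (simp add: matrix_mul_assoc)
qed

lemma holomorphic_Dl: "Dl holomorphic_on UNIV"
  unfolding Dl_def[abs_def] using holomorphic_fundamental[of 1] by (auto intro!: holomorphic_intros)

lemma holomorphic_Emat: "(\<lambda>lam. Emat N k lam $ i $ j) holomorphic_on UNIV"
proof -
  have "\<forall>i j. (\<lambda>lam. Emat N k lam $ i $ j) holomorphic_on UNIV"
    using holomorphic_fundamental[of 1]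
    unfolding forall_2 Emat_def Tk_def Let_def mat2_mult mat2_nth
    by (auto intro!: holomorphic_intros holomorphic_Dl)
  then show ?thesis by blast
qed

lemma holomorphic_Mk_trace: "k < 2 * m + 1 \<Longrightarrow> Mk_trace (2 * m + 1) k holomorphic_on UNIV"
  unfolding Mk_trace_def[abs_def] Dl0_def using holomorphic_fundamental[of 1] ck_nonzero[of k m]
  by (auto intro!: holomorphic_intros holomorphic_Dl)

lemma Mk_char_poly:
  assumes k: "k < 2 * m + 1" and lam: "ph lam 1 \<noteq> 0"
  shows "det (Mk (2 * m + 1) k lam - mat \<tau>)
    = \<tau>\<^sup>2 - \<tau> * Mk_trace (2 * m + 1) k lam + cis (- 2 * pi * real k / real (2 * m + 1))"
  unfolding Mk_trace[OF assms, symmetric] Mk_det[OF assms, symmetric]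
  by (simp add: Mk_entries Let_def det_mat2_minus_mat trace_mat2 det_mat2)

lemma Mk_0_trace:
  assumes lam: "ph lam 1 \<noteq> 0"
  shows "trace (Mk (2 * m + 1) 0 lam) / 2 = Dl0 lam"
  using Mk_trace[of 0 m lam] lam by (simp add: Mk_trace_def sk_def ck_def)

end

theorem theorem1p1:
  fixes m :: nat and q :: "real \<Rightarrow> real"
    and th th' ph ph' :: "complex \<Rightarrow> real \<Rightarrow> complex"
  assumes q_meas: "q \<in> borel_measurable (lebesgue_on {0..1})"
    and q_L2: "integrable (lebesgue_on {0..1}) (\<lambda>t. (q t)^2)"
    and th_sol: "\<And>lam. hill_sol q lam (th lam) (th' lam) \<and> th lam 0 = 1 \<and> th' lam 0 = 0"
    and ph_sol: "\<And>lam. hill_sol q lam (ph lam) (ph' lam) \<and> ph lam 0 = 0 \<and> ph' lam 0 = 1"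
  shows
    "unitarily_equivalent (EdgesN (2*m+1)) (EdgesSum (2*m+1)) (graph_H q (2*m+1)) (graph_sum q (2*m+1))
     \<and>
     (let N = 2*m+1;
          sigD = {lam. ph lam 1 = 0};
          Dl = (\<lambda>lam. (ph' lam 1 + th lam 1) / 2);
          M = (\<lambda>lam. mat2 (th lam 1) (ph lam 1) (th' lam 1) (ph' lam 1));
          R = (\<lambda>lam. mat2 1 0 0 (ph lam 1));
          Dl0 = (\<lambda>lam. 2 * (Dl lam)^2 + th' lam 1 * ph lam 1 / 4 - 1)
      in \<exists>Th Th' Ph Ph' :: nat \<Rightarrow> complex \<Rightarrow> int \<times> nat \<Rightarrow> real \<Rightarrow> complex.
        (\<forall>k<N. \<forall>lam. lam \<notin> sigD \<longrightarrow>
           fam_sol q N k lam (Th k lam) (Th' k lam) \<and>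
           Th k lam (0,0) 0 = 1 \<and> Th' k lam (0,0) 0 = 0 \<and>
           (\<forall>g g'. fam_sol q N k lam g g' \<and> g (0,0) 0 = 1 \<and> g' (0,0) 0 = 0 \<longrightarrow>
              (\<forall>a\<in>Edges1. \<forall>t\<in>{0..1}. g a t = Th k lam a t)) \<and>
           fam_sol q N k lam (Ph k lam) (Ph' k lam) \<and>
           Ph k lam (0,0) 0 = 0 \<and> Ph' k lam (0,0) 0 = 1 \<and>
           (\<forall>g g'. fam_sol q N k lam g g' \<and> g (0,0) 0 = 0 \<and> g' (0,0) 0 = 1 \<longrightarrow>
              (\<forall>a\<in>Edges1. \<forall>t\<in>{0..1}. g a t = Ph k lam a t))) \<and>
        (\<forall>k<N. \<forall>a\<in>Edges1. \<forall>t\<in>{0..1}.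
           (\<lambda>lam. Th k lam a t) meromorphic_on UNIV \<and> (\<lambda>lam. Ph k lam a t) meromorphic_on UNIV) \<and>
        (let Mk = (\<lambda>k lam. mat2 (Th k lam (1,0) 0) (Ph k lam (1,0) 0)
                                (Th' k lam (1,0) 0) (Ph' k lam (1,0) 0))
         in (\<forall>k<N. \<forall>lam. lam \<notin> sigD \<longrightarrow>
               Mk k lam = matrix_inv (R lam) ** Tk N k (Dl lam) ** R lam ** M lam \<and>
               det (Mk k lam) = cis (- 2 * pi * real k / real N) \<and>
               trace (Mk k lam) = 2 * (Dl0 lam + complex_of_real ((sk N k)^2))
                                  / (cis (pi * real k / real N) * complex_of_real (ck N k)) \<and>
               trace (Mk 0 lam) / 2 = Dl0 lam \<and>
               R lam ** Mk k lam ** matrix_inv (R lam)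
                 = Tk N k (Dl lam) ** R lam ** M lam ** matrix_inv (R lam)) \<and>
            (\<forall>k<N. \<exists>E :: complex \<Rightarrow> complex^2^2.
               (\<forall>i j. (\<lambda>lam. E lam $ i $ j) holomorphic_on UNIV) \<and>
               (\<forall>lam. lam \<notin> sigD \<longrightarrow> E lam = R lam ** Mk k lam ** matrix_inv (R lam))) \<and>
            (\<forall>k<N. \<exists>Dk :: complex \<times> complex \<Rightarrow> complex. entire2 Dk \<and>
               (\<forall>lam tau. lam \<notin> sigD \<longrightarrow> Dk (lam, tau) = det (Mk k lam - mat tau)))))"
proof -
  \<comment> \<open>Finiteness of the measure turns square integrability of q into integrability, as
    the locale takes it.\<close>
  interpret finite_measure "lebesgue_on {0..1::real}"
    by (rule finite_measure_lebesgue_on) auto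
  interpret hill_fundamental q th th' ph ph'
    by unfold_locales (use square_integrable_imp_integrable[OF q_meas q_L2] th_sol ph_sol in auto)
  let ?N = "2 * m + 1"
  let ?Th = "\<lambda>k. fam (sN ?N ^ k) (1, 0)" and ?Th' = "\<lambda>k. fam' (sN ?N ^ k) (1, 0)"
  let ?Ph = "\<lambda>k. fam (sN ?N ^ k) (0, 1)" and ?Ph' = "\<lambda>k. fam' (sN ?N ^ k) (0, 1)"
  have Mk: "mat2 (?Th k lam (1, 0) 0) (?Ph k lam (1, 0) 0) (?Th' k lam (1, 0) 0) (?Ph' k lam (1, 0) 0)
      = Mk ?N k lam" for k lam
    by (simp add: Mk_def Let_def)
  have at0: "fam s p lam (0, 0) 0 = fst p" "fam' s p lam (0, 0) 0 = snd p" for s p lam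
    by (simp_all add: fam_at_0 edge_init_def)
  \<comment> \<open>Stated for arbitrary initial data p: (1, 0) yields the family \<Theta>, (0, 1)
    the family \<Phi>.\<close>
  have fam: "fam_sol q ?N k lam (fam (sN ?N ^ k) p lam) (fam' (sN ?N ^ k) p lam) \<and>
      fam (sN ?N ^ k) p lam (0, 0) 0 = fst p \<and> fam' (sN ?N ^ k) p lam (0, 0) 0 = snd p \<and>
      (\<forall>g g'. fam_sol q ?N k lam g g' \<and> g (0, 0) 0 = fst p \<and> g' (0, 0) 0 = snd p \<longrightarrow>
        (\<forall>a\<in>Edges1. \<forall>t\<in>{0..1}. g a t = fam (sN ?N ^ k) p lam a t))"
    if "k < ?N" "ph lam 1 \<noteq> 0" for k lam p
    using fam_sol_fam[OF that(2) one_plus_sN_nonzero[OF that(1)]]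
      fam_sol_unique[OF that(2) one_plus_sN_nonzero[OF that(1)]] at0 by blast
  have mono: "\<forall>k<?N. \<forall>lam. ph lam 1 \<noteq> 0 \<longrightarrow>
      Mk ?N k lam = matrix_inv (Rmat lam) ** Tk ?N k (Dl lam) ** Rmat lam ** Mmat lam \<and>
      det (Mk ?N k lam) = cis (- 2 * pi * real k / real ?N) \<and>
      trace (Mk ?N k lam) = Mk_trace ?N k lam \<and>
      trace (Mk ?N 0 lam) / 2 = Dl0 lam \<and>
      Rmat lam ** Mk ?N k lam ** matrix_inv (Rmat lam)
        = Tk ?N k (Dl lam) ** Rmat lam ** Mmat lam ** matrix_inv (Rmat lam)"
    by (intro allI impI conjI Mk_eq Mk_det Mk_trace Mk_0_trace Mk_conj)
  have entire: "\<forall>k<?N. \<exists>E :: complex \<Rightarrow> complex^2^2.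
      (\<forall>i j. (\<lambda>lam. E lam $ i $ j) holomorphic_on UNIV) \<and>
      (\<forall>lam. ph lam 1 \<noteq> 0 \<longrightarrow> E lam = Rmat lam ** Mk ?N k lam ** matrix_inv (Rmat lam))"
    using holomorphic_Emat Mk_conj(2) by blast
  have entire2: "\<forall>k<?N. \<exists>Dk :: complex \<times> complex \<Rightarrow> complex. entire2 Dk \<and>
      (\<forall>lam tau. ph lam 1 \<noteq> 0 \<longrightarrow> Dk (lam, tau) = det (Mk ?N k lam - mat tau))"
  proof (intro allI impI)
    fix k assume k: "k < ?N"
    show "\<exists>Dk :: complex \<times> complex \<Rightarrow> complex. entire2 Dk \<and>
        (\<forall>lam tau. ph lam 1 \<noteq> 0 \<longrightarrow> Dk (lam, tau) = det (Mk ?N k lam - mat tau))"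
    proof (intro exI conjI)
      \<comment> \<open>With the closed formula in place of the trace, the characteristic polynomial
        extends across sigma_D.\<close>
      show "entire2 (\<lambda>p. (snd p)\<^sup>2 - snd p * Mk_trace ?N k (fst p) + cis (- 2 * pi * real k / real ?N))"
        by (rule entire2_char_poly[OF holomorphic_Mk_trace[OF k]])
    qed (use Mk_char_poly[OF k] in simp)
  qed
  show ?thesis
    unfolding Let_def mem_Collect_eq
  proof (rule conjI, goal_cases)
    case 1
    show ?case by (rule zigzag_unitarily_equivalent) simp
  next
    case 2
    show ?case
    proof (rule exI[of _ ?Th], rule exI[of _ ?Th'], rule exI[of _ ?Ph], rule exI[of _ ?Ph'],
        intro conjI, goal_cases)
      case 1
      show ?case using fam[of _ _ "(1, 0)"] fam[of _ _ "(0, 1)"] by simp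
    next
      case 2
      show ?case by (simp add: meromorphic_fam)
    next
      case 3
      show ?case using mono unfolding Mk Mk_trace_def Rmat_def Mmat_def Dl0_def Dl_def .
    next
      case 4
      show ?case using entire unfolding Mk Rmat_def by simp
    next
      case 5
      show ?case using entire2 unfolding Mk by simp
    qed
  qed
qed

end
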